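(* Let $\mathcal{C}$ be a bicategory. A no-iteration pseudomonad on $\mathcal{C}$ is the same thing as a relative pseudomonad over the identity pseudofunctor $1_{\mathcal{C}}\colon \mathcal{C}\to\mathcal{C}$. That is, replacing the structural invertible 2-cells by their inverses gives a bijective correspondence between relative pseudomonad structures over $1_{\mathcal{C}}$ and no-iteration pseudomonad structures on $\mathcal{C}$.
   Context: Associativity and unit isomorphisms of bicategories are suppressed; "$\cdot$" is vertical composition of 2-cells, juxtaposition is composition of morphisms and whiskering. Relative pseudomonad. Let $J\colon\mathcal{C}\to\mathcal{D}$ be a pseudofunctor of bicategories. A relative pseudomonad $T$ over $J$ consists of: an object $TX\in\mathcal{D}$ for each $X\in\mathcal{C}$; functors $(-)^*\colon\mathcal{D}[JX,TY]\to\mathcal{D}[TX,TY]$ for $X,Y\in\mathcal{C}$; morphisms $i_X\colon JX\to TX$; invertible 2-cells $\mu_{g,f}\colon(g^*f)^*\to g^*f^*$, natural in $f\colon JX\to TY$, $g\colon JY\to TZ$; invertible 2-cells $\eta_f\colon f\to f^*i_X$, natural in $f\colon JX\to TY$; invertible 2-cells $\theta_X\colon (i_X)^*\to 1_{TX}$; such that (associativity) for $f\colon JX\to TY$, $g\colon JY\to TZ$, $h\colon JZ\to TV$: $(h^*\mu_{g,f})\cdot\mu_{h,g^*f}\cdot(\mu_{h,g}f)^*=(\mu_{h,g}f^* )\cdot\mu_{h^*g,f}$ as 2-cells $((h^*g)^*f)^*\to h^*g^*f^*$; (unit) for $f\colon JX\to TY$: $(f^*\theta_X)\cdot\mu_{f,i_X}\cdot(\eta_f)^*=1_{f^*}$.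 No-iteration pseudomonad. A no-iteration pseudomonad on $\mathcal{C}$ consists of: an object $TX$ and a morphism $i_X\colon X\to TX$ for each $X\in\mathcal{C}$; functors $(-)^*\colon\mathcal{C}[X,TY]\to\mathcal{C}[TX,TY]$; invertible 2-cells $\mu'_{g,f}\colon g^*f^*\to(g^*f)^*$, $\eta'_f\colon f^*i_X\to f$, $\theta'_X\colon 1_{TX}\to(i_X)^*$, for $f\colon X\to TY$, $g\colon Y\to TZ$; subject to eight axioms, which, expressed in terms of $\mu=(\mu')^{-1}$, $\eta=(\eta')^{-1}$, $\theta=(\theta')^{-1}$, are: Axiom 1: $(\theta_X i_X)\cdot\eta_{i_X}=1_{i_X}$. Axiom 2: $(f^*\theta_X)\cdot\mu_{f,i_X}\cdot(\eta_f)^*=1_{f^*}$. Axiom 3: $(\theta_Y f^* )\cdot\mu_{i_Y,f}=(\theta_Y f)^*$ for $f\colon X\to TY$. Axiom 4: $\eta_f$ is natural in $f$. Axiom 5: $(\mu_{g,f}i_X)\cdot\eta_{g^*f}=g^*\eta_f$. Axioms 6 and 7: $\mu_{g,f}$ is natural in $f$ and in $g$. Axiom 8: $(h^*\mu_{g,f})\cdot\mu_{h,g^*f}\cdot(\mu_{h,g}f)^*=(\mu_{h,g}f^* )\cdot\mu_{h^*g,f}$. *)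

theory Defs
  imports "HOL-Library.FuncSet"
begin

section \<open>Bicategories\<close>

text \<open>
  Bicategories are not strict here: the associativity and unit isomorphisms that are
  customarily suppressed are part of the data and appear explicitly in all axioms below.
  Composition is written in the order of application of functions: \<open>g \<odot> f\<close> is
  \<open>f\<close> followed by \<open>g\<close>, and \<open>\<beta> \<cdot> \<alpha>\<close> is \<open>\<alpha>\<close> followed by \<open>\<beta>\<close>.
  The operations are only meaningful on composable arguments.
\<close>

record ('o, 'm, 'c) bicat =
  Obj :: "'o set"
  Arr :: "'m set"
  Cell :: "'c set"
  Src :: "'m \<Rightarrow> 'o"
  Trg :: "'m \<Rightarrow> 'o"
  Dom :: "'c \<Rightarrow> 'm"
  Cod :: "'c \<Rightarrow> 'm"
  Id1 :: "'o \<Rightarrow> 'm"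
  Id2 :: "'m \<Rightarrow> 'c"
  Comp1 :: "'m \<Rightarrow> 'm \<Rightarrow> 'm" (infixr "\<odot>\<index>" 70)
  VComp :: "'c \<Rightarrow> 'c \<Rightarrow> 'c" (infixr "\<cdot>\<index>" 55)
  HComp :: "'c \<Rightarrow> 'c \<Rightarrow> 'c" (infixr "\<star>\<index>" 65)
  Assoc :: "'m \<Rightarrow> 'm \<Rightarrow> 'm \<Rightarrow> 'c" (* (h g) f \<rightarrow> h (g f) *)
  LUnit :: "'m \<Rightarrow> 'c" (* 1 f \<rightarrow> f *)
  RUnit :: "'m \<Rightarrow> 'c" (* f 1 \<rightarrow> f *)

definition hom :: "('o, 'm, 'c) bicat \<Rightarrow> 'o \<Rightarrow> 'o \<Rightarrow> 'm set" where
  "hom B X Y = {f \<in> Arr B. Src B f = X \<and> Trg B f = Y}"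

definition cell :: "('o, 'm, 'c) bicat \<Rightarrow> 'm \<Rightarrow> 'm \<Rightarrow> 'c set" where
  "cell B f g = {\<alpha> \<in> Cell B. Dom B \<alpha> = f \<and> Cod B \<alpha> = g}"

text \<open>All 2-cells of the hom-category from \<open>X\<close> to \<open>Y\<close>.\<close>

definition hom_cells :: "('o, 'm, 'c) bicat \<Rightarrow> 'o \<Rightarrow> 'o \<Rightarrow> 'c set" where
  "hom_cells B X Y = (\<Union>f \<in> hom B X Y. \<Union>g \<in> hom B X Y. cell B f g)"

definition inverse_cells :: "('o, 'm, 'c) bicat \<Rightarrow> 'c \<Rightarrow> 'c \<Rightarrow> bool" where
  "inverse_cells B \<alpha> \<beta> \<longleftrightarrow>
     \<alpha> \<in> Cell B \<and> \<beta> \<in> cell B (Cod B \<alpha>) (Dom B \<alpha>) \<and>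
     VComp B \<beta> \<alpha> = Id2 B (Dom B \<alpha>) \<and> VComp B \<alpha> \<beta> = Id2 B (Cod B \<alpha>)"

definition iso_cell :: "('o, 'm, 'c) bicat \<Rightarrow> 'm \<Rightarrow> 'm \<Rightarrow> 'c set" where
  "iso_cell B f g = {\<alpha> \<in> cell B f g. \<exists>\<beta>. inverse_cells B \<alpha> \<beta>}"

definition inv_cell :: "('o, 'm, 'c) bicat \<Rightarrow> 'c \<Rightarrow> 'c" where
  "inv_cell B \<alpha> = (THE \<beta>. inverse_cells B \<alpha> \<beta>)"

abbreviation lwhisker :: "('o, 'm, 'c) bicat \<Rightarrow> 'm \<Rightarrow> 'c \<Rightarrow> 'c" (infixr "\<rhd>\<index>" 65) where
  "lwhisker B g \<alpha> \<equiv> HComp B (Id2 B g) \<alpha>"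

abbreviation rwhisker :: "('o, 'm, 'c) bicat \<Rightarrow> 'c \<Rightarrow> 'm \<Rightarrow> 'c" (infixl "\<lhd>\<index>" 66) where
  "rwhisker B \<alpha> f \<equiv> HComp B \<alpha> (Id2 B f)"

locale bicategory =
  fixes B :: "('o, 'm, 'c) bicat" (structure)
  assumes Src_Obj: "f \<in> Arr B \<Longrightarrow> Src B f \<in> Obj B"
    and Trg_Obj: "f \<in> Arr B \<Longrightarrow> Trg B f \<in> Obj B"
    and Dom_Arr: "\<alpha> \<in> Cell B \<Longrightarrow> Dom B \<alpha> \<in> Arr B"
    and Cod_Arr: "\<alpha> \<in> Cell B \<Longrightarrow> Cod B \<alpha> \<in> Arr B"
    and Src_parallel: "\<alpha> \<in> Cell B \<Longrightarrow> Src B (Dom B \<alpha>) = Src B (Cod B \<alpha>)"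
    and Trg_parallel: "\<alpha> \<in> Cell B \<Longrightarrow> Trg B (Dom B \<alpha>) = Trg B (Cod B \<alpha>)"
    \<comment> \<open>the hom-categories\<close>
    and Id2_cell: "f \<in> Arr B \<Longrightarrow> Id2 B f \<in> cell B f f"
    and VComp_cell: "\<lbrakk>\<alpha> \<in> cell B f g; \<beta> \<in> cell B g h\<rbrakk> \<Longrightarrow> \<beta> \<cdot> \<alpha> \<in> cell B f h"
    and VComp_Id2_left: "\<alpha> \<in> cell B f g \<Longrightarrow> Id2 B g \<cdot> \<alpha> = \<alpha>"
    and VComp_Id2_right: "\<alpha> \<in> cell B f g \<Longrightarrow> \<alpha> \<cdot> Id2 B f = \<alpha>"
    and VComp_assoc: "\<lbrakk>\<alpha> \<in> cell B f g; \<beta> \<in> cell B g h; \<gamma> \<in> cell B h k\<rbrakk>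
          \<Longrightarrow> (\<gamma> \<cdot> \<beta>) \<cdot> \<alpha> = \<gamma> \<cdot> (\<beta> \<cdot> \<alpha>)"
    \<comment> \<open>identity morphisms and the composition functors\<close>
    and Id1_hom: "X \<in> Obj B \<Longrightarrow> Id1 B X \<in> hom B X X"
    and Comp1_hom: "\<lbrakk>f \<in> hom B X Y; g \<in> hom B Y Z\<rbrakk> \<Longrightarrow> g \<odot> f \<in> hom B X Z"
    and HComp_cell: "\<lbrakk>f \<in> hom B X Y; g \<in> hom B Y Z; \<alpha> \<in> cell B f f'; \<beta> \<in> cell B g g'\<rbrakk>
          \<Longrightarrow> \<beta> \<star> \<alpha> \<in> cell B (g \<odot> f) (g' \<odot> f')"
    and HComp_Id2: "\<lbrakk>f \<in> hom B X Y; g \<in> hom B Y Z\<rbrakk>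
          \<Longrightarrow> Id2 B g \<star> Id2 B f = Id2 B (g \<odot> f)"
    and interchange: "\<lbrakk>f \<in> hom B X Y; g \<in> hom B Y Z;
            \<alpha> \<in> cell B f f'; \<alpha>' \<in> cell B f' f''; \<beta> \<in> cell B g g'; \<beta>' \<in> cell B g' g''\<rbrakk>
          \<Longrightarrow> (\<beta>' \<cdot> \<beta>) \<star> (\<alpha>' \<cdot> \<alpha>) = (\<beta>' \<star> \<alpha>') \<cdot> (\<beta> \<star> \<alpha>)"
    \<comment> \<open>associativity and unit isomorphisms\<close>
    and Assoc_iso: "\<lbrakk>f \<in> hom B X Y; g \<in> hom B Y Z; h \<in> hom B Z V\<rbrakk>
          \<Longrightarrow> Assoc B h g f \<in> iso_cell B ((h \<odot> g) \<odot> f) (h \<odot> (g \<odot> f))"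
    and LUnit_iso: "f \<in> hom B X Y \<Longrightarrow> LUnit B f \<in> iso_cell B (Id1 B Y \<odot> f) f"
    and RUnit_iso: "f \<in> hom B X Y \<Longrightarrow> RUnit B f \<in> iso_cell B (f \<odot> Id1 B X) f"
    and Assoc_natural: "\<lbrakk>f \<in> hom B X Y; g \<in> hom B Y Z; h \<in> hom B Z V;
            \<alpha> \<in> cell B f f'; \<beta> \<in> cell B g g'; \<gamma> \<in> cell B h h'\<rbrakk>
          \<Longrightarrow> Assoc B h' g' f' \<cdot> ((\<gamma> \<star> \<beta>) \<star> \<alpha>) = (\<gamma> \<star> (\<beta> \<star> \<alpha>)) \<cdot> Assoc B h g f"
    and LUnit_natural: "\<lbrakk>f \<in> hom B X Y; \<alpha> \<in> cell B f f'\<rbrakk>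
          \<Longrightarrow> LUnit B f' \<cdot> (Id1 B Y \<rhd> \<alpha>) = \<alpha> \<cdot> LUnit B f"
    and RUnit_natural: "\<lbrakk>f \<in> hom B X Y; \<alpha> \<in> cell B f f'\<rbrakk>
          \<Longrightarrow> RUnit B f' \<cdot> (\<alpha> \<lhd> Id1 B X) = \<alpha> \<cdot> RUnit B f"
    and pentagon: "\<lbrakk>f \<in> hom B X Y; g \<in> hom B Y Z; h \<in> hom B Z V; k \<in> hom B V W\<rbrakk>
          \<Longrightarrow> Assoc B k h (g \<odot> f) \<cdot> Assoc B (k \<odot> h) g f
            = (k \<rhd> Assoc B h g f) \<cdot> Assoc B k (h \<odot> g) f \<cdot> (Assoc B k h g \<lhd> f)"
    and triangle: "\<lbrakk>f \<in> hom B X Y; g \<in> hom B Y Z\<rbrakk>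
          \<Longrightarrow> (g \<rhd> LUnit B f) \<cdot> Assoc B g (Id1 B Y) f = RUnit B g \<lhd> f"

text \<open>
  Functors from the hom-category \<open>D[A, A']\<close> to the hom-category \<open>D[E, E']\<close>, given by a map on
  morphisms and a map on 2-cells, both extensional.
\<close>

definition hom_functor ::
    "('o, 'm, 'c) bicat \<Rightarrow> 'o \<Rightarrow> 'o \<Rightarrow> 'o \<Rightarrow> 'o \<Rightarrow> ('m \<Rightarrow> 'm) \<Rightarrow> ('c \<Rightarrow> 'c) \<Rightarrow> bool" where
  "hom_functor D A A' E E' F1 F2 \<longleftrightarrow>
     F1 \<in> hom D A A' \<rightarrow>\<^sub>E hom D E E' \<and>
     F2 \<in> hom_cells D A A' \<rightarrow>\<^sub>E hom_cells D E E' \<and>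
     (\<forall>f \<in> hom D A A'. \<forall>g \<in> hom D A A'. \<forall>\<alpha> \<in> cell D f g. F2 \<alpha> \<in> cell D (F1 f) (F1 g)) \<and>
     (\<forall>f \<in> hom D A A'. F2 (Id2 D f) = Id2 D (F1 f)) \<and>
     (\<forall>f \<in> hom D A A'. \<forall>g \<in> hom D A A'. \<forall>h \<in> hom D A A'.
        \<forall>\<alpha> \<in> cell D f g. \<forall>\<beta> \<in> cell D g h. F2 (VComp D \<beta> \<alpha>) = VComp D (F2 \<beta>) (F2 \<alpha>))"


section \<open>Pseudofunctors\<close>

record ('a, 'b, 'd, 'o, 'm, 'c) psfunctor =
  pobj :: "'a \<Rightarrow> 'o"
  parr :: "'b \<Rightarrow> 'm"
  pcell :: "'d \<Rightarrow> 'c"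
  pcomp :: "'b \<Rightarrow> 'b \<Rightarrow> 'c" (* (J g) (J f) \<rightarrow> J (g f) *)
  punit :: "'a \<Rightarrow> 'c" (* 1 \<rightarrow> J 1 *)

locale pseudofunctor = C: bicategory C + D: bicategory D
  for C :: "('a, 'b, 'd) bicat" and D :: "('o, 'm, 'c) bicat" (structure) +
  fixes J :: "('a, 'b, 'd, 'o, 'm, 'c) psfunctor"
  assumes pobj_Obj: "X \<in> Obj C \<Longrightarrow> pobj J X \<in> Obj D"
    and parr_hom: "f \<in> hom C X Y \<Longrightarrow> parr J f \<in> hom D (pobj J X) (pobj J Y)"
    and pcell_cell: "\<alpha> \<in> cell C f g \<Longrightarrow> pcell J \<alpha> \<in> cell D (parr J f) (parr J g)"
    and pcell_Id2: "f \<in> Arr C \<Longrightarrow> pcell J (Id2 C f) = Id2 D (parr J f)"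
    and pcell_VComp: "\<lbrakk>\<alpha> \<in> cell C f g; \<beta> \<in> cell C g h\<rbrakk>
          \<Longrightarrow> pcell J (\<beta> \<cdot>\<^bsub>C\<^esub> \<alpha>) = pcell J \<beta> \<cdot> pcell J \<alpha>"
    and pcomp_iso: "\<lbrakk>f \<in> hom C X Y; g \<in> hom C Y Z\<rbrakk>
          \<Longrightarrow> pcomp J g f \<in> iso_cell D (parr J g \<odot> parr J f) (parr J (g \<odot>\<^bsub>C\<^esub> f))"
    and punit_iso: "X \<in> Obj C
          \<Longrightarrow> punit J X \<in> iso_cell D (Id1 D (pobj J X)) (parr J (Id1 C X))"
    and pcomp_natural: "\<lbrakk>f \<in> hom C X Y; g \<in> hom C Y Z; \<alpha> \<in> cell C f f'; \<beta> \<in> cell C g g'\<rbrakk>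
          \<Longrightarrow> pcomp J g' f' \<cdot> (pcell J \<beta> \<star> pcell J \<alpha>) = pcell J (\<beta> \<star>\<^bsub>C\<^esub> \<alpha>) \<cdot> pcomp J g f"
    and pcomp_assoc: "\<lbrakk>f \<in> hom C X Y; g \<in> hom C Y Z; h \<in> hom C Z V\<rbrakk>
          \<Longrightarrow> pcell J (Assoc C h g f) \<cdot> pcomp J (h \<odot>\<^bsub>C\<^esub> g) f \<cdot> (pcomp J h g \<lhd> parr J f)
            = pcomp J h (g \<odot>\<^bsub>C\<^esub> f) \<cdot> (parr J h \<rhd> pcomp J g f)
              \<cdot> Assoc D (parr J h) (parr J g) (parr J f)"
    and punit_left: "f \<in> hom C X Y
          \<Longrightarrow> pcell J (LUnit C f) \<cdot> pcomp J (Id1 C Y) f \<cdot> (punit J Y \<lhd> parr J f)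
            = LUnit D (parr J f)"
    and punit_right: "f \<in> hom C X Y
          \<Longrightarrow> pcell J (RUnit C f) \<cdot> pcomp J f (Id1 C X) \<cdot> (parr J f \<rhd> punit J X)
            = RUnit D (parr J f)"

definition id_psfunctor :: "('o, 'm, 'c) bicat \<Rightarrow> ('o, 'm, 'c, 'o, 'm, 'c) psfunctor" where
  "id_psfunctor C = \<lparr>
     pobj = (\<lambda>X. X), parr = (\<lambda>f. f), pcell = (\<lambda>\<alpha>. \<alpha>),
     pcomp = (\<lambda>g f. Id2 C (Comp1 C g f)), punit = (\<lambda>X. Id2 C (Id1 C X))\<rparr>"

context bicategory
begin

lemma iso_cell_cell: "\<alpha> \<in> iso_cell B f g \<Longrightarrow> \<alpha> \<in> cell B f g"
  by (simp add: iso_cell_def)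

lemma hom_Arr: "f \<in> hom B X Y \<Longrightarrow> f \<in> Arr B"
  by (simp add: hom_def)

lemma Id2_iso_cell: "f \<in> Arr B \<Longrightarrow> Id2 B f \<in> iso_cell B f f"
  using Id2_cell[of f] VComp_Id2_left[OF Id2_cell[of f]]
  by (auto simp: iso_cell_def inverse_cells_def cell_def)

lemma pseudofunctor_id: "pseudofunctor B B (id_psfunctor B)"
proof (unfold_locales, simp_all add: id_psfunctor_def)
  show "Id2 B (Comp1 B g f) \<in> iso_cell B (g \<odot> f) (g \<odot> f)"
    if "f \<in> hom B X Y" "g \<in> hom B Y Z" for f g X Y Z
    using that by (meson Comp1_hom Id2_iso_cell hom_Arr)
  show "Id2 B (Id1 B X) \<in> iso_cell B (Id1 B X) (Id1 B X)" if "X \<in> Obj B" for X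
    using that by (meson Id1_hom Id2_iso_cell hom_Arr)
  show "Id2 B (g' \<odot> f') \<cdot> (\<beta> \<star> \<alpha>) = (\<beta> \<star> \<alpha>) \<cdot> Id2 B (g \<odot> f)"
    if "f \<in> hom B X Y" "g \<in> hom B Y Z" "\<alpha> \<in> cell B f f'" "\<beta> \<in> cell B g g'"
    for f g X Y Z f' g' \<alpha> \<beta>
    using HComp_cell[OF that] VComp_Id2_left VComp_Id2_right by simp
  show "Assoc B h g f \<cdot> Id2 B ((h \<odot> g) \<odot> f) \<cdot> (Id2 B (h \<odot> g) \<lhd> f)
      = Id2 B (h \<odot> g \<odot> f) \<cdot> (h \<rhd> Id2 B (g \<odot> f)) \<cdot> Assoc B h g f"
    if f: "f \<in> hom B X Y" and g: "g \<in> hom B Y Z" and h: "h \<in> hom B Z V" for f g h X Y Z V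
  proof -
    have hg: "h \<odot> g \<in> hom B Y V" and gf: "g \<odot> f \<in> hom B X Z"
      using f g h Comp1_hom by blast+
    have l: "(h \<odot> g) \<odot> f \<in> Arr B" and r: "h \<odot> g \<odot> f \<in> Arr B"
      using f h hg gf Comp1_hom hom_Arr by blast+
    show ?thesis
      using iso_cell_cell[OF Assoc_iso[OF f g h]] Id2_cell[OF l] Id2_cell[OF r]
      by (simp add: HComp_Id2[OF f hg] HComp_Id2[OF gf h] VComp_Id2_left VComp_Id2_right)
  qed
  show "LUnit B f \<cdot> Id2 B (Id1 B Y \<odot> f) \<cdot> (Id2 B (Id1 B Y) \<lhd> f) = LUnit B f"
    if f: "f \<in> hom B X Y" for f X Y
  proof -
    have i: "Id1 B Y \<in> hom B Y Y" using f Trg_Obj Id1_hom by (auto simp: hom_def)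
    have l: "Id1 B Y \<odot> f \<in> Arr B" using f i Comp1_hom hom_Arr by blast
    show ?thesis
      using iso_cell_cell[OF LUnit_iso[OF f]] Id2_cell[OF l]
      by (simp add: HComp_Id2[OF f i] VComp_Id2_left VComp_Id2_right)
  qed
  show "RUnit B f \<cdot> Id2 B (f \<odot> Id1 B X) \<cdot> (f \<rhd> Id2 B (Id1 B X)) = RUnit B f"
    if f: "f \<in> hom B X Y" for f X Y
  proof -
    have i: "Id1 B X \<in> hom B X X" using f Src_Obj Id1_hom by (auto simp: hom_def)
    have l: "f \<odot> Id1 B X \<in> Arr B" using f i Comp1_hom hom_Arr by blast
    show ?thesis
      using iso_cell_cell[OF RUnit_iso[OF f]] Id2_cell[OF l]
      by (simp add: HComp_Id2[OF i f] VComp_Id2_left VComp_Id2_right)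
  qed
qed

end



section \<open>Relative pseudomonads\<close>

text \<open>
  The functor \<open>(-)\<^sup>*\<close> depends on \<open>X\<close> and \<open>Y\<close> and not only on the objects \<open>J X\<close> and \<open>T Y\<close>, so
  \<open>ext1\<close> (morphisms) and \<open>ext2\<close> (2-cells), and likewise the structural 2-cells, are indexed by
  objects of \<open>C\<close>.  All components are required to be extensional, so that two structures are equal
  as records precisely if they agree on all meaningful arguments.
\<close>

record ('a, 'o, 'm, 'c) ext_data =
  ob :: "'a \<Rightarrow> 'o"
  un :: "'a \<Rightarrow> 'm"
  ext1 :: "'a \<Rightarrow> 'a \<Rightarrow> 'm \<Rightarrow> 'm"
  ext2 :: "'a \<Rightarrow> 'a \<Rightarrow> 'c \<Rightarrow> 'c"

record ('a, 'o, 'm, 'c) rel_psmonad = "('a, 'o, 'm, 'c) ext_data" +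
  mu :: "'a \<Rightarrow> 'a \<Rightarrow> 'a \<Rightarrow> 'm \<Rightarrow> 'm \<Rightarrow> 'c"
  eta :: "'a \<Rightarrow> 'a \<Rightarrow> 'm \<Rightarrow> 'c"
  theta :: "'a \<Rightarrow> 'c"

locale relative_pseudomonad_data = pseudofunctor C D J
  for C :: "('a, 'b, 'd) bicat" and D :: "('o, 'm, 'c) bicat" (structure)
    and J :: "('a, 'b, 'd, 'o, 'm, 'c) psfunctor" +
  fixes R :: "('a, 'o, 'm, 'c) rel_psmonad"
begin

abbreviation "j \<equiv> pobj J"
abbreviation "T \<equiv> ob R"
abbreviation "i \<equiv> un R"
abbreviation "S \<equiv> ext1 R"
abbreviation "S2 \<equiv> ext2 R"
abbreviation "\<mu> \<equiv> mu R"
abbreviation "\<eta> \<equiv> eta R"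
abbreviation "\<theta> \<equiv> theta R"

end

locale relative_pseudomonad = relative_pseudomonad_data C D J R
  for C :: "('a, 'b, 'd) bicat" and D :: "('o, 'm, 'c) bicat" (structure)
    and J :: "('a, 'b, 'd, 'o, 'm, 'c) psfunctor" and R :: "('a, 'o, 'm, 'c) rel_psmonad" +
  assumes ob_typing: "T \<in> Obj C \<rightarrow>\<^sub>E Obj D"
    and un_typing: "i \<in> (\<Pi>\<^sub>E X \<in> Obj C. hom D (j X) (T X))"
    and ext_extensional: "S \<in> (\<Pi>\<^sub>E X \<in> Obj C. \<Pi>\<^sub>E Y \<in> Obj C. UNIV)"
      "S2 \<in> (\<Pi>\<^sub>E X \<in> Obj C. \<Pi>\<^sub>E Y \<in> Obj C. UNIV)"
    and ext_functor: "\<lbrakk>X \<in> Obj C; Y \<in> Obj C\<rbrakk>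
          \<Longrightarrow> hom_functor D (j X) (T Y) (T X) (T Y) (S X Y) (S2 X Y)"
    and mu_typing: "\<mu> \<in> (\<Pi>\<^sub>E X \<in> Obj C. \<Pi>\<^sub>E Y \<in> Obj C. \<Pi>\<^sub>E Z \<in> Obj C.
          \<Pi>\<^sub>E g \<in> hom D (j Y) (T Z). \<Pi>\<^sub>E f \<in> hom D (j X) (T Y).
            iso_cell D (S X Z (S Y Z g \<odot> f)) (S Y Z g \<odot> S X Y f))"
    and eta_typing: "\<eta> \<in> (\<Pi>\<^sub>E X \<in> Obj C. \<Pi>\<^sub>E Y \<in> Obj C. \<Pi>\<^sub>E f \<in> hom D (j X) (T Y).
            iso_cell D f (S X Y f \<odot> i X))"
    and theta_typing: "\<theta> \<in> (\<Pi>\<^sub>E X \<in> Obj C. iso_cell D (S X X (i X)) (Id1 D (T X)))"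
    and mu_natural_f: "\<lbrakk>X \<in> Obj C; Y \<in> Obj C; Z \<in> Obj C; g \<in> hom D (j Y) (T Z);
            f \<in> hom D (j X) (T Y); f' \<in> hom D (j X) (T Y); \<alpha> \<in> cell D f f'\<rbrakk>
          \<Longrightarrow> (S Y Z g \<rhd> S2 X Y \<alpha>) \<cdot> \<mu> X Y Z g f = \<mu> X Y Z g f' \<cdot> S2 X Z (S Y Z g \<rhd> \<alpha>)"
    and mu_natural_g: "\<lbrakk>X \<in> Obj C; Y \<in> Obj C; Z \<in> Obj C; f \<in> hom D (j X) (T Y);
            g \<in> hom D (j Y) (T Z); g' \<in> hom D (j Y) (T Z); \<beta> \<in> cell D g g'\<rbrakk>
          \<Longrightarrow> (S2 Y Z \<beta> \<lhd> S X Y f) \<cdot> \<mu> X Y Z g f = \<mu> X Y Z g' f \<cdot> S2 X Z (S2 Y Z \<beta> \<lhd> f)"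
    and eta_natural: "\<lbrakk>X \<in> Obj C; Y \<in> Obj C;
            f \<in> hom D (j X) (T Y); f' \<in> hom D (j X) (T Y); \<alpha> \<in> cell D f f'\<rbrakk>
          \<Longrightarrow> (S2 X Y \<alpha> \<lhd> i X) \<cdot> \<eta> X Y f = \<eta> X Y f' \<cdot> \<alpha>"
    and associativity: "\<lbrakk>X \<in> Obj C; Y \<in> Obj C; Z \<in> Obj C; V \<in> Obj C;
            f \<in> hom D (j X) (T Y); g \<in> hom D (j Y) (T Z); h \<in> hom D (j Z) (T V)\<rbrakk>
          \<Longrightarrow> (S Z V h \<rhd> \<mu> X Y Z g f) \<cdot> \<mu> X Z V h (S Y Z g \<odot> f)
              \<cdot> S2 X V (Assoc D (S Z V h) (S Y Z g) f) \<cdot> S2 X V (\<mu> Y Z V h g \<lhd> f)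
            = Assoc D (S Z V h) (S Y Z g) (S X Y f)
              \<cdot> (\<mu> Y Z V h g \<lhd> S X Y f) \<cdot> \<mu> X Y V (S Z V h \<odot> g) f"
    and unit: "\<lbrakk>X \<in> Obj C; Y \<in> Obj C; f \<in> hom D (j X) (T Y)\<rbrakk>
          \<Longrightarrow> RUnit D (S X Y f) \<cdot> (S X Y f \<rhd> \<theta> X) \<cdot> \<mu> X X Y f (i X) \<cdot> S2 X Y (\<eta> X Y f)
            = Id2 D (S X Y f)"


section \<open>No-iteration pseudomonads\<close>

record ('o, 'm, 'c) no_iter_psmonad = "('o, 'o, 'm, 'c) ext_data" +
  mu' :: "'o \<Rightarrow> 'o \<Rightarrow> 'o \<Rightarrow> 'm \<Rightarrow> 'm \<Rightarrow> 'c"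
  eta' :: "'o \<Rightarrow> 'o \<Rightarrow> 'm \<Rightarrow> 'c"
  theta' :: "'o \<Rightarrow> 'c"

locale no_iteration_pseudomonad_data = bicategory C
  for C :: "('o, 'm, 'c) bicat" (structure) +
  fixes N :: "('o, 'm, 'c) no_iter_psmonad"
begin

abbreviation "T \<equiv> ob N"
abbreviation "i \<equiv> un N"
abbreviation "S \<equiv> ext1 N"
abbreviation "S2 \<equiv> ext2 N"

text \<open>The axioms are stated in terms of the inverses of the given invertible 2-cells.\<close>

abbreviation "\<mu> X Y Z g f \<equiv> inv_cell C (mu' N X Y Z g f)"
abbreviation "\<eta> X Y f \<equiv> inv_cell C (eta' N X Y f)"
abbreviation "\<theta> X \<equiv> inv_cell C (theta' N X)"

end

locale no_iteration_pseudomonad = no_iteration_pseudomonad_data C N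
  for C :: "('o, 'm, 'c) bicat" (structure) and N :: "('o, 'm, 'c) no_iter_psmonad" +
  assumes ob_typing: "T \<in> Obj C \<rightarrow>\<^sub>E Obj C"
    and un_typing: "i \<in> (\<Pi>\<^sub>E X \<in> Obj C. hom C X (T X))"
    and ext_extensional: "S \<in> (\<Pi>\<^sub>E X \<in> Obj C. \<Pi>\<^sub>E Y \<in> Obj C. UNIV)"
      "S2 \<in> (\<Pi>\<^sub>E X \<in> Obj C. \<Pi>\<^sub>E Y \<in> Obj C. UNIV)"
    and ext_functor: "\<lbrakk>X \<in> Obj C; Y \<in> Obj C\<rbrakk>
          \<Longrightarrow> hom_functor C X (T Y) (T X) (T Y) (S X Y) (S2 X Y)"
    and mu'_typing: "mu' N \<in> (\<Pi>\<^sub>E X \<in> Obj C. \<Pi>\<^sub>E Y \<in> Obj C. \<Pi>\<^sub>E Z \<in> Obj C.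
          \<Pi>\<^sub>E g \<in> hom C Y (T Z). \<Pi>\<^sub>E f \<in> hom C X (T Y).
            iso_cell C (S Y Z g \<odot> S X Y f) (S X Z (S Y Z g \<odot> f)))"
    and eta'_typing: "eta' N \<in> (\<Pi>\<^sub>E X \<in> Obj C. \<Pi>\<^sub>E Y \<in> Obj C. \<Pi>\<^sub>E f \<in> hom C X (T Y).
            iso_cell C (S X Y f \<odot> i X) f)"
    and theta'_typing: "theta' N \<in> (\<Pi>\<^sub>E X \<in> Obj C. iso_cell C (Id1 C (T X)) (S X X (i X)))"
    and axiom1: "X \<in> Obj C
          \<Longrightarrow> LUnit C (i X) \<cdot> (\<theta> X \<lhd> i X) \<cdot> \<eta> X X (i X) = Id2 C (i X)"
    and axiom2: "\<lbrakk>X \<in> Obj C; Y \<in> Obj C; f \<in> hom C X (T Y)\<rbrakk>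
          \<Longrightarrow> RUnit C (S X Y f) \<cdot> (S X Y f \<rhd> \<theta> X) \<cdot> \<mu> X X Y f (i X) \<cdot> S2 X Y (\<eta> X Y f)
            = Id2 C (S X Y f)"
    and axiom3: "\<lbrakk>X \<in> Obj C; Y \<in> Obj C; f \<in> hom C X (T Y)\<rbrakk>
          \<Longrightarrow> LUnit C (S X Y f) \<cdot> (\<theta> Y \<lhd> S X Y f) \<cdot> \<mu> X Y Y (i Y) f
            = S2 X Y (LUnit C f) \<cdot> S2 X Y (\<theta> Y \<lhd> f)"
    and axiom4: "\<lbrakk>X \<in> Obj C; Y \<in> Obj C;
            f \<in> hom C X (T Y); f' \<in> hom C X (T Y); \<alpha> \<in> cell C f f'\<rbrakk>
          \<Longrightarrow> (S2 X Y \<alpha> \<lhd> i X) \<cdot> \<eta> X Y f = \<eta> X Y f' \<cdot> \<alpha>"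
    and axiom5: "\<lbrakk>X \<in> Obj C; Y \<in> Obj C; Z \<in> Obj C; f \<in> hom C X (T Y); g \<in> hom C Y (T Z)\<rbrakk>
          \<Longrightarrow> Assoc C (S Y Z g) (S X Y f) (i X) \<cdot> (\<mu> X Y Z g f \<lhd> i X) \<cdot> \<eta> X Z (S Y Z g \<odot> f)
            = S Y Z g \<rhd> \<eta> X Y f"
    and axiom6: "\<lbrakk>X \<in> Obj C; Y \<in> Obj C; Z \<in> Obj C; g \<in> hom C Y (T Z);
            f \<in> hom C X (T Y); f' \<in> hom C X (T Y); \<alpha> \<in> cell C f f'\<rbrakk>
          \<Longrightarrow> (S Y Z g \<rhd> S2 X Y \<alpha>) \<cdot> \<mu> X Y Z g f = \<mu> X Y Z g f' \<cdot> S2 X Z (S Y Z g \<rhd> \<alpha>)"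
    and axiom7: "\<lbrakk>X \<in> Obj C; Y \<in> Obj C; Z \<in> Obj C; f \<in> hom C X (T Y);
            g \<in> hom C Y (T Z); g' \<in> hom C Y (T Z); \<beta> \<in> cell C g g'\<rbrakk>
          \<Longrightarrow> (S2 Y Z \<beta> \<lhd> S X Y f) \<cdot> \<mu> X Y Z g f = \<mu> X Y Z g' f \<cdot> S2 X Z (S2 Y Z \<beta> \<lhd> f)"
    and axiom8: "\<lbrakk>X \<in> Obj C; Y \<in> Obj C; Z \<in> Obj C; V \<in> Obj C;
            f \<in> hom C X (T Y); g \<in> hom C Y (T Z); h \<in> hom C Z (T V)\<rbrakk>
          \<Longrightarrow> (S Z V h \<rhd> \<mu> X Y Z g f) \<cdot> \<mu> X Z V h (S Y Z g \<odot> f)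
              \<cdot> S2 X V (Assoc C (S Z V h) (S Y Z g) f) \<cdot> S2 X V (\<mu> Y Z V h g \<lhd> f)
            = Assoc C (S Z V h) (S Y Z g) (S X Y f)
              \<cdot> (\<mu> Y Z V h g \<lhd> S X Y f) \<cdot> \<mu> X Y V (S Z V h \<odot> g) f"


section \<open>The correspondence\<close>

definition invert_structure ::
    "('o, 'm, 'c) bicat \<Rightarrow> ('o, 'o, 'm, 'c) rel_psmonad \<Rightarrow> ('o, 'm, 'c) no_iter_psmonad" where
  "invert_structure C R = \<lparr>
     ob = ob R, un = un R, ext1 = ext1 R, ext2 = ext2 R,
     mu' = (\<lambda>X \<in> Obj C. \<lambda>Y \<in> Obj C. \<lambda>Z \<in> Obj C.
              \<lambda>g \<in> hom C Y (ob R Z). \<lambda>f \<in> hom C X (ob R Y). inv_cell C (mu R X Y Z g f)),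
     eta' = (\<lambda>X \<in> Obj C. \<lambda>Y \<in> Obj C. \<lambda>f \<in> hom C X (ob R Y). inv_cell C (eta R X Y f)),
     theta' = (\<lambda>X \<in> Obj C. inv_cell C (theta R X))\<rparr>"

end

theory Submission
  imports Defs
begin

text \<open>
  Axioms 2, 4, 6, 7 and 8 of a no-iteration pseudomonad are exactly the axioms of a relative
  pseudomonad, so the content is that axioms 1, 3 and 5 are redundant. They play the part of
  \<open>\<lambda>\<^sub>I = \<rho>\<^sub>I\<close> and of the two unit triangles of a monoidal category that Kelly derived from the
  pentagon and the middle triangle, and the proof is his. For axiom 3, instantiate associativity at
  \<open>(i, i, f)\<close> and cancel with the unit axiom: the desired equation holds after applying
  \<open>i\<^sup>* \<rhd> -\<close>, which is faithful because \<open>\<theta> : i\<^sup>* \<rightarrow> 1\<close> is invertible. For axiom 5, instantiate it at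
  \<open>(g, f, i)\<close>: the desired equation holds after applying \<open>(-)\<^sup>*\<close>, which is faithful because \<open>\<eta>\<close> is
  natural and invertible. Axiom 1 follows from axiom 3 at \<open>f = i\<close>, the unit axiom, and
  \<open>\<theta> i\<^sup>* = i\<^sup>* \<theta>\<close>. All of this works over an arbitrary pseudofunctor \<open>J\<close>.
\<close>

section \<open>Calculus of 2-cells in a bicategory\<close>

context bicategory
begin

text \<open>The bicategory axioms are typed by \<open>hom\<close> and \<open>cell\<close>, with
  extra variables for the boundaries. Restated as equations for \<open>Src\<close>,
  \<open>Trg\<close>, \<open>Dom\<close> and \<open>Cod\<close>, they become conditional rewrite
  rules, so that simplification computes boundaries throughout.\<close>

lemma Comp1_simps [simp]:
  assumes "f \<in> Arr B" "g \<in> Arr B" "Src B g = Trg B f"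
  shows "g \<odot> f \<in> Arr B" "Src B (g \<odot> f) = Src B f" "Trg B (g \<odot> f) = Trg B g"
  using Comp1_hom[of f "Src B f" "Trg B f" g "Trg B g"] assms by (auto simp: hom_def)

lemma Id1_simps [simp]:
  assumes "X \<in> Obj B"
  shows "Id1 B X \<in> Arr B" "Src B (Id1 B X) = X" "Trg B (Id1 B X) = X"
  using Id1_hom[OF assms] by (auto simp: hom_def)

lemma Id2_simps [simp]:
  assumes "f \<in> Arr B"
  shows "Id2 B f \<in> Cell B" "Dom B (Id2 B f) = f" "Cod B (Id2 B f) = f"
  using Id2_cell[OF assms] by (auto simp: cell_def)

lemma VComp_simps [simp]:
  assumes "\<alpha> \<in> Cell B" "\<beta> \<in> Cell B" "Cod B \<alpha> = Dom B \<beta>"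
  shows "\<beta> \<cdot> \<alpha> \<in> Cell B" "Dom B (\<beta> \<cdot> \<alpha>) = Dom B \<alpha>" "Cod B (\<beta> \<cdot> \<alpha>) = Cod B \<beta>"
  using VComp_cell[of \<alpha> "Dom B \<alpha>" "Cod B \<alpha>" \<beta> "Cod B \<beta>"] assms by (auto simp: cell_def)

lemma HComp_simps [simp]:
  assumes "\<alpha> \<in> Cell B" "\<beta> \<in> Cell B" "Src B (Dom B \<beta>) = Trg B (Dom B \<alpha>)"
  shows "\<beta> \<star> \<alpha> \<in> Cell B" "Dom B (\<beta> \<star> \<alpha>) = Dom B \<beta> \<odot> Dom B \<alpha>"
    "Cod B (\<beta> \<star> \<alpha>) = Cod B \<beta> \<odot> Cod B \<alpha>"
  using HComp_cell[of "Dom B \<alpha>" "Src B (Dom B \<alpha>)" "Trg B (Dom B \<alpha>)" "Dom B \<beta>" "Trg B (Dom B \<beta>)"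
      \<alpha> "Cod B \<alpha>" \<beta> "Cod B \<beta>"] assms
  by (auto simp: cell_def hom_def Dom_Arr)

text \<open>The boundary enters as an equation, so the rules also apply when \<open>f\<close> is
  only provably equal to the codomain or domain of \<alpha>.\<close>

lemma VComp_Id2_simps [simp]:
  assumes "\<alpha> \<in> Cell B"
  shows "Cod B \<alpha> = f \<Longrightarrow> Id2 B f \<cdot> \<alpha> = \<alpha>" "Dom B \<alpha> = f \<Longrightarrow> \<alpha> \<cdot> Id2 B f = \<alpha>"
  using VComp_Id2_left[of \<alpha>] VComp_Id2_right[of \<alpha>] assms by (auto simp: cell_def)

text \<open>Vertical composites are normalised to the right; steps below that only move parentheses
  rest on this.\<close>

lemma VComp_assoc_simp [simp]:
  assumes "\<alpha> \<in> Cell B" "\<beta> \<in> Cell B" "\<gamma> \<in> Cell B" "Cod B \<alpha> = Dom B \<beta>" "Cod B \<beta> = Dom B \<gamma>"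
  shows "(\<gamma> \<cdot> \<beta>) \<cdot> \<alpha> = \<gamma> \<cdot> \<beta> \<cdot> \<alpha>"
  using VComp_assoc[of \<alpha> "Dom B \<alpha>" "Cod B \<alpha>" \<beta> "Cod B \<beta>" \<gamma> "Cod B \<gamma>"] assms
  by (auto simp: cell_def)

lemma HComp_Id2_simp [simp]:
  assumes "f \<in> Arr B" "g \<in> Arr B" "Src B g = Trg B f"
  shows "Id2 B g \<star> Id2 B f = Id2 B (g \<odot> f)"
  using HComp_Id2[of f "Src B f" "Trg B f" g "Trg B g"] assms by (auto simp: hom_def)

text \<open>Oriented so as to merge two layers into one: identities then cancel, and two ways of
  sliding 2-cells past each other get the same normal form.\<close>

lemma interchange_cells:
  assumes "\<alpha> \<in> Cell B" "\<alpha>' \<in> Cell B" "\<beta> \<in> Cell B" "\<beta>' \<in> Cell B"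
    and "Cod B \<alpha> = Dom B \<alpha>'" "Cod B \<beta> = Dom B \<beta>'" "Src B (Dom B \<beta>) = Trg B (Dom B \<alpha>)"
  shows "(\<beta>' \<star> \<alpha>') \<cdot> (\<beta> \<star> \<alpha>) = (\<beta>' \<cdot> \<beta>) \<star> (\<alpha>' \<cdot> \<alpha>)"
  using interchange[of "Dom B \<alpha>" "Src B (Dom B \<alpha>)" "Trg B (Dom B \<alpha>)" "Dom B \<beta>" "Trg B (Dom B \<beta>)"
      \<alpha> "Cod B \<alpha>" \<alpha>' "Cod B \<alpha>'" \<beta> "Cod B \<beta>" \<beta>' "Cod B \<beta>'"] assms
  by (auto simp: cell_def hom_def Dom_Arr)

text \<open>Interchange with an identity 2-cell, oriented the other way: it spreads a whiskering
  over a vertical composite.\<close>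

lemma lwhisker_VComp:
  assumes "\<alpha> \<in> Cell B" "\<beta> \<in> Cell B" "Cod B \<alpha> = Dom B \<beta>" "g \<in> Arr B" "Src B g = Trg B (Dom B \<alpha>)"
  shows "g \<rhd> (\<beta> \<cdot> \<alpha>) = (g \<rhd> \<beta>) \<cdot> (g \<rhd> \<alpha>)"
  using interchange_cells[of \<alpha> \<beta> "Id2 B g" "Id2 B g"] assms by simp

lemma rwhisker_VComp:
  assumes "\<alpha> \<in> Cell B" "\<beta> \<in> Cell B" "Cod B \<alpha> = Dom B \<beta>" "f \<in> Arr B" "Src B (Dom B \<alpha>) = Trg B f"
  shows "(\<beta> \<cdot> \<alpha>) \<lhd> f = (\<beta> \<lhd> f) \<cdot> (\<alpha> \<lhd> f)"
  using interchange_cells[of "Id2 B f" "Id2 B f" \<alpha> \<beta>] assms by simp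

lemma iso_cell_simps:
  assumes "\<alpha> \<in> iso_cell B f g"
  shows "\<alpha> \<in> Cell B" "Dom B \<alpha> = f" "Cod B \<alpha> = g"
  using assms by (auto simp: iso_cell_def cell_def)

lemma Assoc_simps [simp]:
  assumes "f \<in> Arr B" "g \<in> Arr B" "h \<in> Arr B" "Src B g = Trg B f" "Src B h = Trg B g"
  shows "Assoc B h g f \<in> Cell B" "Dom B (Assoc B h g f) = (h \<odot> g) \<odot> f"
    "Cod B (Assoc B h g f) = h \<odot> g \<odot> f"
  using iso_cell_simps[OF Assoc_iso[of f "Src B f" "Trg B f" g "Trg B g" h "Trg B h"]] assms
  by (auto simp: hom_def)

lemma LUnit_simps [simp]:
  assumes "f \<in> Arr B"
  shows "LUnit B f \<in> Cell B" "Trg B f = Y \<Longrightarrow> Dom B (LUnit B f) = Id1 B Y \<odot> f" "Cod B (LUnit B f) = f"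
  using iso_cell_simps[OF LUnit_iso[of f "Src B f" "Trg B f"]] assms by (auto simp: hom_def)

lemma RUnit_simps [simp]:
  assumes "f \<in> Arr B"
  shows "RUnit B f \<in> Cell B" "Src B f = X \<Longrightarrow> Dom B (RUnit B f) = f \<odot> Id1 B X" "Cod B (RUnit B f) = f"
  using iso_cell_simps[OF RUnit_iso[of f "Src B f" "Trg B f"]] assms by (auto simp: hom_def)

declare Src_Obj [simp] Trg_Obj [simp] Dom_Arr [simp] Cod_Arr [simp]

section \<open>Invertible 2-cells and cancellation\<close>

lemma iso_cellE:
  assumes "\<alpha> \<in> iso_cell B f g"
  obtains \<beta> where "\<beta> \<in> Cell B" "Dom B \<beta> = g" "Cod B \<beta> = f"
    "\<beta> \<cdot> \<alpha> = Id2 B f" "\<alpha> \<cdot> \<beta> = Id2 B g"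
  using assms by (auto simp: iso_cell_def inverse_cells_def cell_def)

lemma iso_cellI:
  assumes "\<alpha> \<in> Cell B" "Dom B \<alpha> = f" "Cod B \<alpha> = g"
    and "\<beta> \<in> Cell B" "Dom B \<beta> = g" "Cod B \<beta> = f"
    and "\<beta> \<cdot> \<alpha> = Id2 B f" "\<alpha> \<cdot> \<beta> = Id2 B g"
  shows "\<alpha> \<in> iso_cell B f g"
  using assms by (auto simp: iso_cell_def inverse_cells_def cell_def)

text \<open>Uniqueness is what gives meaning to the definite description in
  \<open>inv_cell\<close>.\<close>

lemma inverse_cells_unique:
  assumes "inverse_cells B \<alpha> \<beta>" "inverse_cells B \<alpha> \<gamma>"
  shows "\<beta> = \<gamma>"
proof -
  note i = assms[unfolded inverse_cells_def cell_def, simplified]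
  have "\<beta> = \<beta> \<cdot> \<alpha> \<cdot> \<gamma>" using i by simp
  also have "\<dots> = (\<beta> \<cdot> \<alpha>) \<cdot> \<gamma>" by (rule VComp_assoc_simp[symmetric]) (use i in simp_all)
  also have "\<dots> = \<gamma>" using i by simp
  finally show ?thesis .
qed

lemma inv_cell_eq: "inverse_cells B \<alpha> \<beta> \<Longrightarrow> inv_cell B \<alpha> = \<beta>"
  unfolding inv_cell_def by (blast intro: inverse_cells_unique)

lemma inverse_cells_inv_cell: "\<alpha> \<in> iso_cell B f g \<Longrightarrow> inverse_cells B \<alpha> (inv_cell B \<alpha>)"
  by (auto simp: iso_cell_def inv_cell_eq)

lemma inverse_cells_sym: "inverse_cells B \<alpha> \<beta> \<Longrightarrow> inverse_cells B \<beta> \<alpha>"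
  by (auto simp: inverse_cells_def cell_def)

lemma inv_cell_iso:
  assumes "\<alpha> \<in> iso_cell B f g"
  shows "inv_cell B \<alpha> \<in> iso_cell B g f"
  using inverse_cells_inv_cell[OF assms] inverse_cells_sym[OF inverse_cells_inv_cell[OF assms]]
    assms by (auto simp: iso_cell_def inverse_cells_def cell_def)

text \<open>This involutivity makes the two translations of structures mutually inverse.\<close>

lemma inv_cell_inv_cell: "\<alpha> \<in> iso_cell B f g \<Longrightarrow> inv_cell B (inv_cell B \<alpha>) = \<alpha>"
  by (rule inv_cell_eq[OF inverse_cells_sym[OF inverse_cells_inv_cell]])

lemma iso_cell_cancel_left:
  assumes "\<alpha> \<in> iso_cell B f g" "\<alpha> \<cdot> \<beta> = \<alpha> \<cdot> \<gamma>"
    and "\<beta> \<in> Cell B" "Cod B \<beta> = f" "\<gamma> \<in> Cell B" "Cod B \<gamma> = f"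
  shows "\<beta> = \<gamma>"
proof -
  obtain \<delta> where \<delta>: "\<delta> \<in> Cell B" "Dom B \<delta> = g" "Cod B \<delta> = f" "\<delta> \<cdot> \<alpha> = Id2 B f"
    using assms(1) by (rule iso_cellE)
  have "(\<delta> \<cdot> \<alpha>) \<cdot> \<beta> = (\<delta> \<cdot> \<alpha>) \<cdot> \<gamma>"
    using iso_cell_simps[OF assms(1)] assms \<delta>(1-3) by simp
  then show ?thesis using \<delta> assms by simp
qed

lemma iso_cell_cancel_right:
  assumes "\<alpha> \<in> iso_cell B f g" "\<beta> \<cdot> \<alpha> = \<gamma> \<cdot> \<alpha>"
    and "\<beta> \<in> Cell B" "Dom B \<beta> = g" "\<gamma> \<in> Cell B" "Dom B \<gamma> = g"
  shows "\<beta> = \<gamma>"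
proof -
  obtain \<delta> where \<delta>: "\<delta> \<in> Cell B" "Dom B \<delta> = g" "Cod B \<delta> = f" "\<alpha> \<cdot> \<delta> = Id2 B g"
    using assms(1) by (rule iso_cellE)
  have "\<beta> \<cdot> \<alpha> \<cdot> \<delta> = (\<beta> \<cdot> \<alpha>) \<cdot> \<delta>" "\<gamma> \<cdot> \<alpha> \<cdot> \<delta> = (\<gamma> \<cdot> \<alpha>) \<cdot> \<delta>"
    using iso_cell_simps[OF assms(1)] assms(3-) \<delta>(1-3) by simp_all
  then show ?thesis using \<delta> assms by simp
qed

lemma iso_cell_VComp:
  assumes "\<alpha> \<in> iso_cell B f g" "\<beta> \<in> iso_cell B g h"
  shows "\<beta> \<cdot> \<alpha> \<in> iso_cell B f h"
proof -
  note t = iso_cell_simps[OF assms(1)] iso_cell_simps[OF assms(2)]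
  obtain \<alpha>' where \<alpha>': "\<alpha>' \<in> Cell B" "Dom B \<alpha>' = g" "Cod B \<alpha>' = f"
    and i: "\<alpha>' \<cdot> \<alpha> = Id2 B f" "\<alpha> \<cdot> \<alpha>' = Id2 B g"
    using assms(1) by (rule iso_cellE)
  obtain \<beta>' where \<beta>': "\<beta>' \<in> Cell B" "Dom B \<beta>' = h" "Cod B \<beta>' = g"
    and j: "\<beta>' \<cdot> \<beta> = Id2 B g" "\<beta> \<cdot> \<beta>' = Id2 B h"
    using assms(2) by (rule iso_cellE)
  show ?thesis
  proof (rule iso_cellI[of _ _ _ "\<alpha>' \<cdot> \<beta>'"])
    have "(\<alpha>' \<cdot> \<beta>') \<cdot> \<beta> \<cdot> \<alpha> = \<alpha>' \<cdot> (\<beta>' \<cdot> \<beta>) \<cdot> \<alpha>" using t \<alpha>' \<beta>' by simp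
    then show "(\<alpha>' \<cdot> \<beta>') \<cdot> \<beta> \<cdot> \<alpha> = Id2 B f" using t i j by simp
    have "(\<beta> \<cdot> \<alpha>) \<cdot> \<alpha>' \<cdot> \<beta>' = \<beta> \<cdot> (\<alpha> \<cdot> \<alpha>') \<cdot> \<beta>'" using t \<alpha>' \<beta>' by simp
    then show "(\<beta> \<cdot> \<alpha>) \<cdot> \<alpha>' \<cdot> \<beta>' = Id2 B h" using \<beta>' i j by simp
  qed (use t \<alpha>' \<beta>' in simp_all)
qed

lemma iso_cell_HComp:
  assumes "\<alpha> \<in> iso_cell B f f'" "\<beta> \<in> iso_cell B g g'" "Src B g = Trg B f"
  shows "\<beta> \<star> \<alpha> \<in> iso_cell B (g \<odot> f) (g' \<odot> f')"
proof -
  note t = iso_cell_simps[OF assms(1)] iso_cell_simps[OF assms(2)]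
  obtain \<alpha>' where \<alpha>': "\<alpha>' \<in> Cell B" "Dom B \<alpha>' = f'" "Cod B \<alpha>' = f"
    and i: "\<alpha>' \<cdot> \<alpha> = Id2 B f" "\<alpha> \<cdot> \<alpha>' = Id2 B f'"
    using assms(1) by (rule iso_cellE)
  obtain \<beta>' where \<beta>': "\<beta>' \<in> Cell B" "Dom B \<beta>' = g'" "Cod B \<beta>' = g"
    and j: "\<beta>' \<cdot> \<beta> = Id2 B g" "\<beta> \<cdot> \<beta>' = Id2 B g'"
    using assms(2) by (rule iso_cellE)
  have a: "f \<in> Arr B" "f' \<in> Arr B" "g \<in> Arr B" "g' \<in> Arr B"
    using t Dom_Arr Cod_Arr by blast+
  have s: "Src B g' = Trg B f'"
    using Src_parallel[of \<beta>] Trg_parallel[of \<alpha>] t assms(3) by simp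
  show ?thesis
    by (rule iso_cellI[of _ _ _ "\<beta>' \<star> \<alpha>'"])
      (use t \<alpha>' \<beta>' i j a s assms(3) in \<open>simp_all add: interchange_cells\<close>)
qed

section \<open>Naturality and coherence of the unit isomorphisms\<close>

lemma Assoc_naturality:
  assumes "\<alpha> \<in> Cell B" "\<beta> \<in> Cell B" "\<gamma> \<in> Cell B"
    "Src B (Dom B \<beta>) = Trg B (Dom B \<alpha>)" "Src B (Dom B \<gamma>) = Trg B (Dom B \<beta>)"
  shows "Assoc B (Cod B \<gamma>) (Cod B \<beta>) (Cod B \<alpha>) \<cdot> ((\<gamma> \<star> \<beta>) \<star> \<alpha>)
    = (\<gamma> \<star> \<beta> \<star> \<alpha>) \<cdot> Assoc B (Dom B \<gamma>) (Dom B \<beta>) (Dom B \<alpha>)"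
  using Assoc_natural[of "Dom B \<alpha>" "Src B (Dom B \<alpha>)" "Trg B (Dom B \<alpha>)" "Dom B \<beta>" "Trg B (Dom B \<beta>)"
      "Dom B \<gamma>" "Trg B (Dom B \<gamma>)" \<alpha> "Cod B \<alpha>" \<beta> "Cod B \<beta>" \<gamma> "Cod B \<gamma>"] assms
  by (auto simp: cell_def hom_def)

lemma LUnit_naturality:
  assumes "\<alpha> \<in> Cell B" "Trg B (Dom B \<alpha>) = Y"
  shows "LUnit B (Cod B \<alpha>) \<cdot> (Id1 B Y \<rhd> \<alpha>) = \<alpha> \<cdot> LUnit B (Dom B \<alpha>)"
  using LUnit_natural[of "Dom B \<alpha>" "Src B (Dom B \<alpha>)" Y \<alpha> "Cod B \<alpha>"] assms
  by (auto simp: cell_def hom_def)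

lemma RUnit_naturality:
  assumes "\<alpha> \<in> Cell B" "Src B (Dom B \<alpha>) = X"
  shows "RUnit B (Cod B \<alpha>) \<cdot> (\<alpha> \<lhd> Id1 B X) = \<alpha> \<cdot> RUnit B (Dom B \<alpha>)"
  using RUnit_natural[of "Dom B \<alpha>" X "Trg B (Dom B \<alpha>)" \<alpha> "Cod B \<alpha>"] assms
  by (auto simp: cell_def hom_def)

text \<open>Naturality of \<open>LUnit\<close> expresses
  \<open>\<alpha> \<cdot> LUnit B (Dom B \<alpha>)\<close> through the whiskered 2-cell, and the
  invertible \<open>LUnit\<close> cancels.\<close>

lemma Id1_lwhisker_faithful:
  assumes "Id1 B Y \<rhd> \<alpha> = Id1 B Y \<rhd> \<beta>"
    and "\<alpha> \<in> Cell B" "\<beta> \<in> Cell B" "Dom B \<alpha> = Dom B \<beta>" "Cod B \<alpha> = Cod B \<beta>" "Trg B (Dom B \<beta>) = Y"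
  shows "\<alpha> = \<beta>"
proof (rule iso_cell_cancel_right)
  show "LUnit B (Dom B \<alpha>) \<in> iso_cell B (Id1 B Y \<odot> Dom B \<alpha>) (Dom B \<alpha>)"
    using LUnit_iso[of "Dom B \<alpha>" "Src B (Dom B \<alpha>)" Y] assms by (simp add: hom_def)
  show "\<alpha> \<cdot> LUnit B (Dom B \<alpha>) = \<beta> \<cdot> LUnit B (Dom B \<alpha>)"
    using LUnit_naturality[of \<alpha> Y] LUnit_naturality[of \<beta> Y] assms by simp
qed (use assms in simp_all)

lemma Id1_rwhisker_faithful:
  assumes "\<alpha> \<lhd> Id1 B X = \<beta> \<lhd> Id1 B X"
    and "\<alpha> \<in> Cell B" "\<beta> \<in> Cell B" "Dom B \<alpha> = Dom B \<beta>" "Cod B \<alpha> = Cod B \<beta>" "Src B (Dom B \<beta>) = X"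
  shows "\<alpha> = \<beta>"
proof (rule iso_cell_cancel_right)
  show "RUnit B (Dom B \<alpha>) \<in> iso_cell B (Dom B \<alpha> \<odot> Id1 B X) (Dom B \<alpha>)"
    using RUnit_iso[of "Dom B \<alpha>" X "Trg B (Dom B \<alpha>)"] assms by (simp add: hom_def)
  show "\<alpha> \<cdot> RUnit B (Dom B \<alpha>) = \<beta> \<cdot> RUnit B (Dom B \<alpha>)"
    using RUnit_naturality[of \<alpha> X] RUnit_naturality[of \<beta> X] assms by simp
qed (use assms in simp_all)

text \<open>
  Kelly's argument: after whiskering with the identity, the pentagon and two instances of the
  triangle identity give the claim.
\<close>

lemma RUnit_Comp1:
  assumes f: "f \<in> hom B X Y" and g: "g \<in> hom B Y Z"
  shows "(g \<rhd> RUnit B f) \<cdot> Assoc B g f (Id1 B X) = RUnit B (g \<odot> f)"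
proof -
  let ?I = "Id1 B X"
  have fg [simp]: "f \<in> Arr B" "Src B f = X" "Trg B f = Y" "g \<in> Arr B" "Src B g = Y" "Trg B g = Z"
    using f g by (auto simp: hom_def)
  have X [simp]: "X \<in> Obj B" using Src_Obj[of f] by simp
  have I: "?I \<in> hom B X X" by (simp add: hom_def)
  have "Assoc B g f ?I \<cdot> (RUnit B (g \<odot> f) \<lhd> ?I)
      = Assoc B g f ?I \<cdot> (g \<odot> f \<rhd> LUnit B ?I) \<cdot> Assoc B (g \<odot> f) ?I ?I"
    using triangle[OF I Comp1_hom[OF f g]] by simp
  \<comment> \<open>The identity of \<open>g \<odot> f\<close> is split as a horizontal composite so
    that naturality of the associator applies.\<close>
  also have "\<dots> = (Assoc B g f ?I \<cdot> ((g \<rhd> Id2 B f) \<star> LUnit B ?I)) \<cdot> Assoc B (g \<odot> f) ?I ?I"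
    by simp
  also have "Assoc B g f ?I \<cdot> ((g \<rhd> Id2 B f) \<star> LUnit B ?I)
      = (g \<rhd> (f \<rhd> LUnit B ?I)) \<cdot> Assoc B g f (?I \<odot> ?I)"
    using Assoc_naturality[of "LUnit B ?I" "Id2 B f" "Id2 B g"] by simp
  also have "((g \<rhd> (f \<rhd> LUnit B ?I)) \<cdot> Assoc B g f (?I \<odot> ?I)) \<cdot> Assoc B (g \<odot> f) ?I ?I
      = (g \<rhd> (f \<rhd> LUnit B ?I)) \<cdot> Assoc B g f (?I \<odot> ?I) \<cdot> Assoc B (g \<odot> f) ?I ?I"
    by simp
  also have "\<dots> = (g \<rhd> (f \<rhd> LUnit B ?I)) \<cdot> (g \<rhd> Assoc B f ?I ?I)
      \<cdot> Assoc B g (f \<odot> ?I) ?I \<cdot> (Assoc B g f ?I \<lhd> ?I)"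
    using pentagon[OF I I f g] by simp
  also have "\<dots> = (g \<rhd> ((f \<rhd> LUnit B ?I) \<cdot> Assoc B f ?I ?I))
      \<cdot> Assoc B g (f \<odot> ?I) ?I \<cdot> (Assoc B g f ?I \<lhd> ?I)"
    by (simp add: lwhisker_VComp)
  also have "(f \<rhd> LUnit B ?I) \<cdot> Assoc B f ?I ?I = RUnit B f \<lhd> ?I"
    by (rule triangle[OF I f])
  also have "(g \<rhd> (RUnit B f \<lhd> ?I)) \<cdot> Assoc B g (f \<odot> ?I) ?I \<cdot> (Assoc B g f ?I \<lhd> ?I)
      = ((g \<rhd> (RUnit B f \<lhd> ?I)) \<cdot> Assoc B g (f \<odot> ?I) ?I) \<cdot> (Assoc B g f ?I \<lhd> ?I)"
    by simp
  also have "(g \<rhd> (RUnit B f \<lhd> ?I)) \<cdot> Assoc B g (f \<odot> ?I) ?I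
      = Assoc B g f ?I \<cdot> ((g \<rhd> RUnit B f) \<lhd> ?I)"
    using Assoc_naturality[of "Id2 B ?I" "RUnit B f" "Id2 B g"] by simp
  also have "(Assoc B g f ?I \<cdot> ((g \<rhd> RUnit B f) \<lhd> ?I)) \<cdot> (Assoc B g f ?I \<lhd> ?I)
      = Assoc B g f ?I \<cdot> (((g \<rhd> RUnit B f) \<cdot> Assoc B g f ?I) \<lhd> ?I)"
    by (simp add: rwhisker_VComp)
  \<comment> \<open>Both ends of the chain start with the same invertible associator on the left,
    which cancels.\<close>
  finally have "RUnit B (g \<odot> f) \<lhd> ?I = ((g \<rhd> RUnit B f) \<cdot> Assoc B g f ?I) \<lhd> ?I"
    by (rule iso_cell_cancel_left[OF Assoc_iso[OF I f g]]) simp_all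
  then show ?thesis
    by (rule Id1_rwhisker_faithful[symmetric]) simp_all
qed

text \<open>Both unit isomorphisms, whiskered with the identity and composed with the associator,
  agree: the triangle identity evaluates one, \<open>RUnit_Comp1\<close> the other.\<close>

lemma LUnit_Id1:
  assumes [simp]: "X \<in> Obj B"
  shows "LUnit B (Id1 B X) = RUnit B (Id1 B X)"
proof -
  let ?I = "Id1 B X"
  have I: "?I \<in> hom B X X" by (simp add: hom_def)
  \<comment> \<open>Naturality of \<open>RUnit\<close> is applied to the 2-cell
    \<open>RUnit B ?I\<close> itself.\<close>
  have "RUnit B ?I \<cdot> (RUnit B ?I \<lhd> ?I) = RUnit B ?I \<cdot> RUnit B (?I \<odot> ?I)"
    using RUnit_naturality[of "RUnit B ?I" X] by simp
  then have "RUnit B ?I \<lhd> ?I = RUnit B (?I \<odot> ?I)"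
    by (rule iso_cell_cancel_left[OF RUnit_iso[OF I]]) simp_all
  then have "(?I \<rhd> LUnit B ?I) \<cdot> Assoc B ?I ?I ?I = (?I \<rhd> RUnit B ?I) \<cdot> Assoc B ?I ?I ?I"
    using triangle[OF I I] RUnit_Comp1[OF I I] by simp
  then have "?I \<rhd> LUnit B ?I = ?I \<rhd> RUnit B ?I"
    by (rule iso_cell_cancel_right[OF Assoc_iso[OF I I I]]) simp_all
  then show ?thesis
    by (rule Id1_lwhisker_faithful) simp_all
qed

end

section \<open>The redundant axioms\<close>

context relative_pseudomonad
begin

section \<open>Typing rules for the data of a relative pseudomonad\<close>

lemma ob_simps [simp]:
  assumes "X \<in> Obj C"
  shows "j X \<in> Obj D" "T X \<in> Obj D"
  using assms pobj_Obj ob_typing by auto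

lemma un_simps [simp]:
  assumes "X \<in> Obj C"
  shows "i X \<in> Arr D" "Src D (i X) = j X" "Trg D (i X) = T X"
  using PiE_mem[OF un_typing assms] by (auto simp: hom_def)

lemma ext1_simps [simp]:
  assumes "X \<in> Obj C" "Y \<in> Obj C" "f \<in> Arr D" "Src D f = j X" "Trg D f = T Y"
  shows "S X Y f \<in> Arr D" "Src D (S X Y f) = T X" "Trg D (S X Y f) = T Y"
  using ext_functor[OF assms(1,2)] assms(3-) by (auto simp: hom_functor_def hom_def)

lemma ext2_simps [simp]:
  assumes "X \<in> Obj C" "Y \<in> Obj C" "\<alpha> \<in> Cell D" "Src D (Dom D \<alpha>) = j X" "Trg D (Dom D \<alpha>) = T Y"
  shows "S2 X Y \<alpha> \<in> Cell D" "Dom D (S2 X Y \<alpha>) = S X Y (Dom D \<alpha>)"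
    "Cod D (S2 X Y \<alpha>) = S X Y (Cod D \<alpha>)"
proof -
  have "Dom D \<alpha> \<in> hom D (j X) (T Y)" "Cod D \<alpha> \<in> hom D (j X) (T Y)" "\<alpha> \<in> cell D (Dom D \<alpha>) (Cod D \<alpha>)"
    using assms D.Src_parallel[of \<alpha>] D.Trg_parallel[of \<alpha>] by (auto simp: hom_def cell_def)
  then have "S2 X Y \<alpha> \<in> cell D (S X Y (Dom D \<alpha>)) (S X Y (Cod D \<alpha>))"
    using ext_functor[OF assms(1,2)] unfolding hom_functor_def by blast
  then show "S2 X Y \<alpha> \<in> Cell D" "Dom D (S2 X Y \<alpha>) = S X Y (Dom D \<alpha>)"
    "Cod D (S2 X Y \<alpha>) = S X Y (Cod D \<alpha>)"
    by (auto simp: cell_def)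
qed

lemma ext2_Id2 [simp]:
  assumes "X \<in> Obj C" "Y \<in> Obj C" "f \<in> Arr D" "Src D f = j X" "Trg D f = T Y"
  shows "S2 X Y (Id2 D f) = Id2 D (S X Y f)"
  using ext_functor[OF assms(1,2)] assms(3-) by (auto simp: hom_functor_def hom_def)

lemma ext2_VComp:
  assumes "X \<in> Obj C" "Y \<in> Obj C" "\<alpha> \<in> Cell D" "\<beta> \<in> Cell D" "Cod D \<alpha> = Dom D \<beta>"
    "Src D (Dom D \<alpha>) = j X" "Trg D (Dom D \<alpha>) = T Y"
  shows "S2 X Y (\<beta> \<cdot> \<alpha>) = S2 X Y \<beta> \<cdot> S2 X Y \<alpha>"
proof -
  have "Dom D \<alpha> \<in> hom D (j X) (T Y)" "Dom D \<beta> \<in> hom D (j X) (T Y)" "Cod D \<beta> \<in> hom D (j X) (T Y)"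
    "\<alpha> \<in> cell D (Dom D \<alpha>) (Dom D \<beta>)" "\<beta> \<in> cell D (Dom D \<beta>) (Cod D \<beta>)"
    using assms D.Src_parallel[of \<alpha>] D.Trg_parallel[of \<alpha>] D.Src_parallel[of \<beta>] D.Trg_parallel[of \<beta>]
    by (auto simp: hom_def cell_def)
  then show ?thesis
    using ext_functor[OF assms(1,2)] unfolding hom_functor_def by blast
qed

lemma mu_iso:
  assumes "X \<in> Obj C" "Y \<in> Obj C" "Z \<in> Obj C" "g \<in> hom D (j Y) (T Z)" "f \<in> hom D (j X) (T Y)"
  shows "\<mu> X Y Z g f \<in> iso_cell D (S X Z (S Y Z g \<odot> f)) (S Y Z g \<odot> S X Y f)"
  using mu_typing assms by (auto simp: PiE_iff)

lemma eta_iso: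
  assumes "X \<in> Obj C" "Y \<in> Obj C" "f \<in> hom D (j X) (T Y)"
  shows "\<eta> X Y f \<in> iso_cell D f (S X Y f \<odot> i X)"
  using eta_typing assms by (auto simp: PiE_iff)

lemma theta_iso: "X \<in> Obj C \<Longrightarrow> \<theta> X \<in> iso_cell D (S X X (i X)) (Id1 D (T X))"
  using theta_typing by (auto simp: PiE_iff)

lemma mu_simps [simp]:
  assumes "X \<in> Obj C" "Y \<in> Obj C" "Z \<in> Obj C" "g \<in> Arr D" "Src D g = j Y" "Trg D g = T Z"
    "f \<in> Arr D" "Src D f = j X" "Trg D f = T Y"
  shows "\<mu> X Y Z g f \<in> Cell D" "Dom D (\<mu> X Y Z g f) = S X Z (S Y Z g \<odot> f)"
    "Cod D (\<mu> X Y Z g f) = S Y Z g \<odot> S X Y f"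
  using D.iso_cell_simps[OF mu_iso[of X Y Z g f]] assms by (auto simp: hom_def)

lemma eta_simps [simp]:
  assumes "X \<in> Obj C" "Y \<in> Obj C" "f \<in> Arr D" "Src D f = j X" "Trg D f = T Y"
  shows "\<eta> X Y f \<in> Cell D" "Dom D (\<eta> X Y f) = f" "Cod D (\<eta> X Y f) = S X Y f \<odot> i X"
  using D.iso_cell_simps[OF eta_iso[of X Y f]] assms by (auto simp: hom_def)

lemma theta_simps [simp]:
  assumes "X \<in> Obj C"
  shows "\<theta> X \<in> Cell D" "Dom D (\<theta> X) = S X X (i X)" "Cod D (\<theta> X) = Id1 D (T X)"
  using D.iso_cell_simps[OF theta_iso[OF assms]] by auto

text \<open>By naturality of \<eta>, the 2-cell \<open>S2 X Y \<alpha>\<close> determines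
  \<open>\<eta> X Y (Cod D \<alpha>) \<cdot> \<alpha>\<close>, and \<eta> is invertible.\<close>

lemma ext2_faithful:
  assumes XY: "X \<in> Obj C" "Y \<in> Obj C" and "S2 X Y \<alpha> = S2 X Y \<beta>"
    and \<alpha>\<beta>: "\<alpha> \<in> Cell D" "\<beta> \<in> Cell D" "Dom D \<alpha> = Dom D \<beta>" "Cod D \<alpha> = Cod D \<beta>"
    and "Src D (Dom D \<beta>) = j X" "Trg D (Dom D \<beta>) = T Y"
  shows "\<alpha> = \<beta>"
proof (rule D.iso_cell_cancel_left)
  have hom: "Dom D \<beta> \<in> hom D (j X) (T Y)" "Cod D \<beta> \<in> hom D (j X) (T Y)"
    using assms D.Src_parallel[of \<beta>] D.Trg_parallel[of \<beta>] by (auto simp: hom_def)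
  show "\<eta> X Y (Cod D \<beta>) \<in> iso_cell D (Cod D \<beta>) (S X Y (Cod D \<beta>) \<odot> i X)"
    by (rule eta_iso[OF XY hom(2)])
  show "\<eta> X Y (Cod D \<beta>) \<cdot> \<alpha> = \<eta> X Y (Cod D \<beta>) \<cdot> \<beta>"
    using eta_natural[OF XY hom, of \<alpha>] eta_natural[OF XY hom, of \<beta>] assms
    by (simp add: cell_def)
qed (use \<alpha>\<beta> in simp_all)

text \<open>
  With the unit isomorphisms suppressed, \<open>theta_left Y f\<close> and \<open>theta_right X f\<close> are the whiskerings
  \<open>\<theta>\<^sub>Y f\<close> and \<open>f \<theta>\<^sub>X\<close>.
\<close>

definition theta_left :: "'a \<Rightarrow> 'm \<Rightarrow> 'c" where
  "theta_left Y f = LUnit D f \<cdot> (\<theta> Y \<lhd> f)"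

definition theta_right :: "'a \<Rightarrow> 'm \<Rightarrow> 'c" where
  "theta_right X f = RUnit D f \<cdot> (f \<rhd> \<theta> X)"

section \<open>Whiskerings of \<theta> as unit isomorphisms for \<open>S X X (i X)\<close>\<close>

lemma theta_left_simps [simp]:
  assumes "Y \<in> Obj C" "f \<in> Arr D" "Trg D f = T Y"
  shows "theta_left Y f \<in> Cell D" "Dom D (theta_left Y f) = S Y Y (i Y) \<odot> f" "Cod D (theta_left Y f) = f"
  using assms by (simp_all add: theta_left_def)

lemma theta_right_simps [simp]:
  assumes "X \<in> Obj C" "f \<in> Arr D" "Src D f = T X"
  shows "theta_right X f \<in> Cell D" "Dom D (theta_right X f) = f \<odot> S X X (i X)" "Cod D (theta_right X f) = f"
  using assms by (simp_all add: theta_right_def)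

lemma theta_left_iso:
  assumes "Y \<in> Obj C" "f \<in> Arr D" "Trg D f = T Y"
  shows "theta_left Y f \<in> iso_cell D (S Y Y (i Y) \<odot> f) f"
  unfolding theta_left_def
  by (rule D.iso_cell_VComp[OF D.iso_cell_HComp[OF D.Id2_iso_cell theta_iso] D.LUnit_iso])
    (use assms in \<open>simp_all add: hom_def\<close>)

lemma theta_right_iso:
  assumes "X \<in> Obj C" "f \<in> Arr D" "Src D f = T X"
  shows "theta_right X f \<in> iso_cell D (f \<odot> S X X (i X)) f"
  unfolding theta_right_def
  by (rule D.iso_cell_VComp[OF D.iso_cell_HComp[OF theta_iso D.Id2_iso_cell] D.RUnit_iso])
    (use assms in \<open>simp_all add: hom_def\<close>)

text \<open>Interchange slides \<alpha> past \<theta>; naturality of \<open>LUnit\<close> does the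
  rest.\<close>

lemma theta_left_natural:
  assumes "Y \<in> Obj C" "\<alpha> \<in> Cell D" "Dom D \<alpha> = f" "Cod D \<alpha> = f'" "Trg D f = T Y"
  shows "theta_left Y f' \<cdot> (S Y Y (i Y) \<rhd> \<alpha>) = \<alpha> \<cdot> theta_left Y f"
proof -
  have [simp]: "f \<in> Arr D" "f' \<in> Arr D" "Trg D f' = T Y"
    using assms D.Trg_parallel[of \<alpha>] D.Dom_Arr[of \<alpha>] D.Cod_Arr[of \<alpha>] by auto
  note [simp] = assms
  have "theta_left Y f' \<cdot> (S Y Y (i Y) \<rhd> \<alpha>) = LUnit D f' \<cdot> (\<theta> Y \<lhd> f') \<cdot> (S Y Y (i Y) \<rhd> \<alpha>)"
    by (simp add: theta_left_def)
  also have "(\<theta> Y \<lhd> f') \<cdot> (S Y Y (i Y) \<rhd> \<alpha>) = (Id1 D (T Y) \<rhd> \<alpha>) \<cdot> (\<theta> Y \<lhd> f)"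
    by (simp add: D.interchange_cells)
  also have "LUnit D f' \<cdot> (Id1 D (T Y) \<rhd> \<alpha>) \<cdot> (\<theta> Y \<lhd> f)
      = (LUnit D f' \<cdot> (Id1 D (T Y) \<rhd> \<alpha>)) \<cdot> (\<theta> Y \<lhd> f)"
    by simp
  also have "LUnit D f' \<cdot> (Id1 D (T Y) \<rhd> \<alpha>) = \<alpha> \<cdot> LUnit D f"
    using D.LUnit_naturality[of \<alpha> "T Y"] by simp
  finally show ?thesis by (simp add: theta_left_def)
qed

lemma theta_right_natural:
  assumes "X \<in> Obj C" "\<alpha> \<in> Cell D" "Dom D \<alpha> = f" "Cod D \<alpha> = f'" "Src D f = T X"
  shows "theta_right X f' \<cdot> (\<alpha> \<lhd> S X X (i X)) = \<alpha> \<cdot> theta_right X f"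
proof -
  have [simp]: "f \<in> Arr D" "f' \<in> Arr D" "Src D f' = T X"
    using assms D.Src_parallel[of \<alpha>] D.Dom_Arr[of \<alpha>] D.Cod_Arr[of \<alpha>] by auto
  note [simp] = assms
  have "theta_right X f' \<cdot> (\<alpha> \<lhd> S X X (i X)) = RUnit D f' \<cdot> (f' \<rhd> \<theta> X) \<cdot> (\<alpha> \<lhd> S X X (i X))"
    by (simp add: theta_right_def)
  also have "(f' \<rhd> \<theta> X) \<cdot> (\<alpha> \<lhd> S X X (i X)) = (\<alpha> \<lhd> Id1 D (T X)) \<cdot> (f \<rhd> \<theta> X)"
    by (simp add: D.interchange_cells)
  also have "RUnit D f' \<cdot> (\<alpha> \<lhd> Id1 D (T X)) \<cdot> (f \<rhd> \<theta> X)
      = (RUnit D f' \<cdot> (\<alpha> \<lhd> Id1 D (T X))) \<cdot> (f \<rhd> \<theta> X)"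
    by simp
  also have "RUnit D f' \<cdot> (\<alpha> \<lhd> Id1 D (T X)) = \<alpha> \<cdot> RUnit D f"
    using D.RUnit_naturality[of \<alpha> "T X"] by simp
  finally show ?thesis by (simp add: theta_right_def)
qed

text \<open>The triangle identity with \<open>S Y Y (i Y)\<close> in place of the identity morphism,
  transported along \<theta> by naturality of the associator.\<close>

lemma theta_triangle:
  assumes [simp]: "Y \<in> Obj C" "f \<in> Arr D" "h \<in> Arr D" "Trg D f = T Y" "Src D h = T Y"
  shows "(h \<rhd> theta_left Y f) \<cdot> Assoc D h (S Y Y (i Y)) f = theta_right Y h \<lhd> f"
proof -
  have "(h \<rhd> theta_left Y f) \<cdot> Assoc D h (S Y Y (i Y)) f
      = (h \<rhd> LUnit D f) \<cdot> (h \<rhd> (\<theta> Y \<lhd> f)) \<cdot> Assoc D h (S Y Y (i Y)) f"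
    by (simp add: theta_left_def D.lwhisker_VComp)
  also have "(h \<rhd> (\<theta> Y \<lhd> f)) \<cdot> Assoc D h (S Y Y (i Y)) f
      = Assoc D h (Id1 D (T Y)) f \<cdot> ((h \<rhd> \<theta> Y) \<lhd> f)"
    using D.Assoc_naturality[of "Id2 D f" "\<theta> Y" "Id2 D h"] by simp
  also have "(h \<rhd> LUnit D f) \<cdot> Assoc D h (Id1 D (T Y)) f \<cdot> ((h \<rhd> \<theta> Y) \<lhd> f)
      = ((h \<rhd> LUnit D f) \<cdot> Assoc D h (Id1 D (T Y)) f) \<cdot> ((h \<rhd> \<theta> Y) \<lhd> f)"
    by simp
  also have "(h \<rhd> LUnit D f) \<cdot> Assoc D h (Id1 D (T Y)) f = RUnit D h \<lhd> f"
    by (rule D.triangle[of _ "Src D f" "T Y" _ "Trg D h"]) (simp_all add: hom_def)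
  finally show ?thesis by (simp add: theta_right_def D.rwhisker_VComp)
qed

text \<open>The analogue of \<open>RUnit_Comp1\<close>, transported along \<theta> in the same
  way.\<close>

lemma theta_right_Comp1:
  assumes [simp]: "X \<in> Obj C" "f \<in> Arr D" "g \<in> Arr D" "Src D f = T X" "Src D g = Trg D f"
  shows "(g \<rhd> theta_right X f) \<cdot> Assoc D g f (S X X (i X)) = theta_right X (g \<odot> f)"
proof -
  have "(g \<rhd> theta_right X f) \<cdot> Assoc D g f (S X X (i X))
      = (g \<rhd> RUnit D f) \<cdot> (g \<rhd> (f \<rhd> \<theta> X)) \<cdot> Assoc D g f (S X X (i X))"
    by (simp add: theta_right_def D.lwhisker_VComp)
  also have "(g \<rhd> (f \<rhd> \<theta> X)) \<cdot> Assoc D g f (S X X (i X))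
      = Assoc D g f (Id1 D (T X)) \<cdot> (g \<odot> f \<rhd> \<theta> X)"
    using D.Assoc_naturality[of "\<theta> X" "Id2 D f" "Id2 D g"] by simp
  also have "(g \<rhd> RUnit D f) \<cdot> Assoc D g f (Id1 D (T X)) \<cdot> (g \<odot> f \<rhd> \<theta> X)
      = ((g \<rhd> RUnit D f) \<cdot> Assoc D g f (Id1 D (T X))) \<cdot> (g \<odot> f \<rhd> \<theta> X)"
    by simp
  also have "(g \<rhd> RUnit D f) \<cdot> Assoc D g f (Id1 D (T X)) = RUnit D (g \<odot> f)"
    by (rule D.RUnit_Comp1[of _ _ "Trg D f" _ "Trg D g"]) (simp_all add: hom_def)
  finally show ?thesis by (simp add: theta_right_def)
qed

section \<open>Derivation of axioms 3, 5 and 1\<close>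

lemma unit_theta_right:
  assumes "X \<in> Obj C" "Y \<in> Obj C" "f \<in> Arr D" "Src D f = j X" "Trg D f = T Y"
  shows "theta_right X (S X Y f) \<cdot> \<mu> X X Y f (i X) \<cdot> S2 X Y (\<eta> X Y f) = Id2 D (S X Y f)"
  using unit[of X Y f] assms by (simp add: theta_right_def hom_def)

text \<open>The argument of \<open>Id1_lwhisker_faithful\<close>, with the natural isomorphism
  \<open>theta_left\<close> replacing \<open>LUnit\<close>.\<close>

lemma ext_un_lwhisker_faithful:
  assumes Y: "Y \<in> Obj C" and "S Y Y (i Y) \<rhd> \<alpha> = S Y Y (i Y) \<rhd> \<beta>"
    and "\<alpha> \<in> Cell D" "\<beta> \<in> Cell D" "Dom D \<alpha> = Dom D \<beta>" "Cod D \<alpha> = Cod D \<beta>" "Trg D (Dom D \<beta>) = T Y"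
  shows "\<alpha> = \<beta>"
proof (rule D.iso_cell_cancel_right)
  show "theta_left Y (Dom D \<alpha>) \<in> iso_cell D (S Y Y (i Y) \<odot> Dom D \<alpha>) (Dom D \<alpha>)"
    by (rule theta_left_iso) (use assms in simp_all)
  show "\<alpha> \<cdot> theta_left Y (Dom D \<alpha>) = \<beta> \<cdot> theta_left Y (Dom D \<alpha>)"
    using theta_left_natural[of Y \<alpha>] theta_left_natural[of Y \<beta>] assms by simp
qed (use assms in simp_all)

text \<open>Axiom 3. Associativity at \<open>i Y\<close>, \<open>i Y\<close>, \<open>f\<close>
  yields the equation whiskered with \<open>S Y Y (i Y)\<close>, and that whiskering is
  faithful.\<close>

lemma theta_left_mu:
  assumes [simp]: "X \<in> Obj C" "Y \<in> Obj C" and f: "f \<in> hom D (j X) (T Y)"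
  shows "theta_left Y (S X Y f) \<cdot> \<mu> X Y Y (i Y) f = S2 X Y (theta_left Y f)"
proof -
  have [simp]: "f \<in> Arr D" "Src D f = j X" "Trg D f = T Y" using f by (auto simp: hom_def)
  have i: "i Y \<in> hom D (j Y) (T Y)" by (simp add: hom_def)
  let ?H = "S Y Y (i Y)"
  let ?m = "\<mu> Y Y Y (i Y) (i Y)"
  let ?e = "\<eta> Y Y (i Y)"
  let ?F = "S X Y f"
  \<comment> \<open>The unit axiom at \<open>i Y\<close> whiskered with \<open>x\<close>, brought to
    this form by \<open>theta_triangle\<close>. It is used both for \<open>x = f\<close> and for
    \<open>x = ?F\<close>.\<close>
  have W: "(?H \<rhd> theta_left Y x) \<cdot> Assoc D ?H ?H x \<cdot> (?m \<lhd> x) \<cdot> (S2 Y Y ?e \<lhd> x) = Id2 D (?H \<odot> x)"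
    if [simp]: "x \<in> Arr D" "Trg D x = T Y" for x
  proof -
    have "(?H \<rhd> theta_left Y x) \<cdot> Assoc D ?H ?H x \<cdot> (?m \<lhd> x) \<cdot> (S2 Y Y ?e \<lhd> x)
      = ((?H \<rhd> theta_left Y x) \<cdot> Assoc D ?H ?H x) \<cdot> (?m \<lhd> x) \<cdot> (S2 Y Y ?e \<lhd> x)"
      by simp
    also have "\<dots> = (theta_right Y ?H \<cdot> ?m \<cdot> S2 Y Y ?e) \<lhd> x"
      by (simp add: theta_triangle D.rwhisker_VComp)
    finally show ?thesis by (simp add: unit_theta_right)
  qed
  \<comment> \<open>A right inverse of an invertible 2-cell is also its left inverse.\<close>
  have W': "(Assoc D ?H ?H f \<cdot> (?m \<lhd> f) \<cdot> (S2 Y Y ?e \<lhd> f)) \<cdot> (?H \<rhd> theta_left Y f)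
      = Id2 D (?H \<odot> ?H \<odot> f)"
  proof (rule D.iso_cell_cancel_left)
    show "?H \<rhd> theta_left Y f \<in> iso_cell D (?H \<odot> ?H \<odot> f) (?H \<odot> f)"
      by (rule D.iso_cell_HComp[OF theta_left_iso D.Id2_iso_cell]) simp_all
    have "(?H \<rhd> theta_left Y f) \<cdot> (Assoc D ?H ?H f \<cdot> (?m \<lhd> f) \<cdot> (S2 Y Y ?e \<lhd> f)) \<cdot> (?H \<rhd> theta_left Y f)
      = ((?H \<rhd> theta_left Y f) \<cdot> Assoc D ?H ?H f \<cdot> (?m \<lhd> f) \<cdot> (S2 Y Y ?e \<lhd> f)) \<cdot> (?H \<rhd> theta_left Y f)"
      by simp
    also have "\<dots> = (?H \<rhd> theta_left Y f) \<cdot> Id2 D (?H \<odot> ?H \<odot> f)"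
      by (subst W) simp_all
    finally show "(?H \<rhd> theta_left Y f) \<cdot> (Assoc D ?H ?H f \<cdot> (?m \<lhd> f) \<cdot> (S2 Y Y ?e \<lhd> f)) \<cdot> (?H \<rhd> theta_left Y f)
      = (?H \<rhd> theta_left Y f) \<cdot> Id2 D (?H \<odot> ?H \<odot> f)" .
  qed simp_all
  have assoc: "(?H \<rhd> \<mu> X Y Y (i Y) f) \<cdot> \<mu> X Y Y (i Y) (?H \<odot> f) \<cdot> S2 X Y (Assoc D ?H ?H f) \<cdot> S2 X Y (?m \<lhd> f)
      = Assoc D ?H ?H ?F \<cdot> (?m \<lhd> ?F) \<cdot> \<mu> X Y Y (?H \<odot> i Y) f"
    by (rule associativity) (simp_all add: f i)
  have nat_g: "(S2 Y Y ?e \<lhd> ?F) \<cdot> \<mu> X Y Y (i Y) f = \<mu> X Y Y (?H \<odot> i Y) f \<cdot> S2 X Y (S2 Y Y ?e \<lhd> f)"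
    by (rule mu_natural_g) (simp_all add: hom_def cell_def)
  have nat_f: "(?H \<rhd> S2 X Y (theta_left Y f)) \<cdot> \<mu> X Y Y (i Y) (?H \<odot> f)
      = \<mu> X Y Y (i Y) f \<cdot> S2 X Y (?H \<rhd> theta_left Y f)"
    by (rule mu_natural_f) (simp_all add: hom_def cell_def)
  let ?A = "?H \<rhd> theta_left Y ?F"
  \<comment> \<open>An identity is inserted in the form \<open>W'\<close>, which creates the left
    side of associativity. Reassociation is switched off at first because it would destroy the
    pattern of \<open>W'\<close>.\<close>
  have "(?A \<cdot> (?H \<rhd> \<mu> X Y Y (i Y) f)) \<cdot> \<mu> X Y Y (i Y) (?H \<odot> f)
    = ?A \<cdot> (?H \<rhd> \<mu> X Y Y (i Y) f) \<cdot> \<mu> X Y Y (i Y) (?H \<odot> f)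
        \<cdot> S2 X Y ((Assoc D ?H ?H f \<cdot> (?m \<lhd> f) \<cdot> (S2 Y Y ?e \<lhd> f)) \<cdot> (?H \<rhd> theta_left Y f))"
    by (simp add: W' del: D.VComp_assoc_simp) simp
  also have "\<dots> = ?A \<cdot> ((?H \<rhd> \<mu> X Y Y (i Y) f) \<cdot> \<mu> X Y Y (i Y) (?H \<odot> f) \<cdot> S2 X Y (Assoc D ?H ?H f) \<cdot> S2 X Y (?m \<lhd> f))
        \<cdot> S2 X Y (S2 Y Y ?e \<lhd> f) \<cdot> S2 X Y (?H \<rhd> theta_left Y f)"
    by (simp add: ext2_VComp)
  also have "\<dots> = ?A \<cdot> Assoc D ?H ?H ?F \<cdot> (?m \<lhd> ?F)
      \<cdot> (\<mu> X Y Y (?H \<odot> i Y) f \<cdot> S2 X Y (S2 Y Y ?e \<lhd> f)) \<cdot> S2 X Y (?H \<rhd> theta_left Y f)"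
    unfolding assoc by simp
  also have "\<dots> = (?A \<cdot> Assoc D ?H ?H ?F \<cdot> (?m \<lhd> ?F) \<cdot> (S2 Y Y ?e \<lhd> ?F))
      \<cdot> \<mu> X Y Y (i Y) f \<cdot> S2 X Y (?H \<rhd> theta_left Y f)"
    unfolding nat_g[symmetric] by simp
  also have "\<dots> = \<mu> X Y Y (i Y) f \<cdot> S2 X Y (?H \<rhd> theta_left Y f)"
    by (subst W) simp_all
  finally have "(?A \<cdot> (?H \<rhd> \<mu> X Y Y (i Y) f)) \<cdot> \<mu> X Y Y (i Y) (?H \<odot> f)
    = (?H \<rhd> S2 X Y (theta_left Y f)) \<cdot> \<mu> X Y Y (i Y) (?H \<odot> f)"
    by (simp only: nat_f)
  \<comment> \<open>The common factor \<open>\<mu> X Y Y (i Y) (?H \<odot> f)\<close> is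
    invertible.\<close>
  then have "?A \<cdot> (?H \<rhd> \<mu> X Y Y (i Y) f) = ?H \<rhd> S2 X Y (theta_left Y f)"
    by (rule D.iso_cell_cancel_right[rotated, OF _ _ _ _ _ mu_iso]) (simp_all add: hom_def)
  then have "?H \<rhd> (theta_left Y ?F \<cdot> \<mu> X Y Y (i Y) f) = ?H \<rhd> S2 X Y (theta_left Y f)"
    by (simp add: D.lwhisker_VComp)
  then show ?thesis
    by (rule ext_un_lwhisker_faithful[rotated]) simp_all
qed

text \<open>Axiom 5. Both sides, after applying \<open>S2 X Z\<close>, become
  \<open>\<mu> X Y Z g f\<close> when followed by one and the same invertible 2-cell.\<close>

lemma mu_eta:
  assumes [simp]: "X \<in> Obj C" "Y \<in> Obj C" "Z \<in> Obj C"
    and f: "f \<in> hom D (j X) (T Y)" and g: "g \<in> hom D (j Y) (T Z)"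
  shows "Assoc D (S Y Z g) (S X Y f) (i X) \<cdot> (\<mu> X Y Z g f \<lhd> i X) \<cdot> \<eta> X Z (S Y Z g \<odot> f)
    = S Y Z g \<rhd> \<eta> X Y f"
    (is "?E = ?E'")
proof -
  have [simp]: "f \<in> Arr D" "Src D f = j X" "Trg D f = T Y" "g \<in> Arr D" "Src D g = j Y" "Trg D g = T Z"
    using f g by (auto simp: hom_def)
  have i: "i X \<in> hom D (j X) (T X)" by (simp add: hom_def)
  let ?F = "S X Y f"
  let ?G = "S Y Z g"
  let ?I = "S X X (i X)"
  let ?m = "\<mu> X Y Z g f"
  let ?A = "?G \<rhd> theta_right X ?F"
  \<comment> \<open>Its last two factors are those of associativity at \<open>g\<close>,
    \<open>f\<close>, \<open>i X\<close>; \<open>?A\<close> then removes the extended unit.\<close>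
  let ?B = "?A \<cdot> (?G \<rhd> \<mu> X X Y f (i X)) \<cdot> \<mu> X Y Z g (?F \<odot> i X)"
  have assoc: "(?G \<rhd> \<mu> X X Y f (i X)) \<cdot> \<mu> X Y Z g (?F \<odot> i X) \<cdot> S2 X Z (Assoc D ?G ?F (i X)) \<cdot> S2 X Z (?m \<lhd> i X)
      = Assoc D ?G ?F ?I \<cdot> (?m \<lhd> ?I) \<cdot> \<mu> X X Z (?G \<odot> f) (i X)"
    by (rule associativity) (simp_all add: f g i)
  have nat_f: "(?G \<rhd> S2 X Y (\<eta> X Y f)) \<cdot> ?m = \<mu> X Y Z g (?F \<odot> i X) \<cdot> S2 X Z (?G \<rhd> \<eta> X Y f)"
    by (rule mu_natural_f) (simp_all add: hom_def cell_def)
  \<comment> \<open>This side needs associativity and ends with the unit axiom at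
    \<open>?G \<odot> f\<close>.\<close>
  have "?B \<cdot> S2 X Z ?E = ?A \<cdot> ((?G \<rhd> \<mu> X X Y f (i X)) \<cdot> \<mu> X Y Z g (?F \<odot> i X)
      \<cdot> S2 X Z (Assoc D ?G ?F (i X)) \<cdot> S2 X Z (?m \<lhd> i X)) \<cdot> S2 X Z (\<eta> X Z (?G \<odot> f))"
    by (simp add: ext2_VComp)
  also have "\<dots> = (?A \<cdot> Assoc D ?G ?F ?I) \<cdot> (?m \<lhd> ?I) \<cdot> \<mu> X X Z (?G \<odot> f) (i X) \<cdot> S2 X Z (\<eta> X Z (?G \<odot> f))"
    unfolding assoc by simp
  also have "?A \<cdot> Assoc D ?G ?F ?I = theta_right X (?G \<odot> ?F)"
    by (rule theta_right_Comp1) simp_all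
  also have "theta_right X (?G \<odot> ?F) \<cdot> (?m \<lhd> ?I) \<cdot> \<mu> X X Z (?G \<odot> f) (i X) \<cdot> S2 X Z (\<eta> X Z (?G \<odot> f))
      = (theta_right X (?G \<odot> ?F) \<cdot> (?m \<lhd> ?I)) \<cdot> \<mu> X X Z (?G \<odot> f) (i X) \<cdot> S2 X Z (\<eta> X Z (?G \<odot> f))"
    by simp
  also have "theta_right X (?G \<odot> ?F) \<cdot> (?m \<lhd> ?I) = ?m \<cdot> theta_right X (S X Z (?G \<odot> f))"
    by (rule theta_right_natural) simp_all
  also have "(?m \<cdot> theta_right X (S X Z (?G \<odot> f))) \<cdot> \<mu> X X Z (?G \<odot> f) (i X) \<cdot> S2 X Z (\<eta> X Z (?G \<odot> f))
      = ?m \<cdot> theta_right X (S X Z (?G \<odot> f)) \<cdot> \<mu> X X Z (?G \<odot> f) (i X) \<cdot> S2 X Z (\<eta> X Z (?G \<odot> f))"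
    by simp
  also have "\<dots> = ?m"
    by (simp add: unit_theta_right)
  finally have E: "?B \<cdot> S2 X Z ?E = ?m" .
  \<comment> \<open>This side needs naturality of \<mu> in its last argument and the unit axiom at
    \<open>f\<close>.\<close>
  have "?B \<cdot> S2 X Z ?E' = ?A \<cdot> (?G \<rhd> \<mu> X X Y f (i X)) \<cdot> (\<mu> X Y Z g (?F \<odot> i X) \<cdot> S2 X Z (?G \<rhd> \<eta> X Y f))"
    by simp
  also have "\<dots> = (?G \<rhd> (theta_right X ?F \<cdot> \<mu> X X Y f (i X) \<cdot> S2 X Y (\<eta> X Y f))) \<cdot> ?m"
    unfolding nat_f[symmetric] by (simp add: D.lwhisker_VComp)
  also have "\<dots> = ?m"
    by (simp add: unit_theta_right)
  finally have eq: "?B \<cdot> S2 X Z ?E = ?B \<cdot> S2 X Z ?E'" using E by simp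
  have "?B \<in> iso_cell D (S X Z (?G \<odot> ?F \<odot> i X)) (?G \<odot> ?F)"
  proof (intro D.iso_cell_VComp)
    show "\<mu> X Y Z g (?F \<odot> i X) \<in> iso_cell D (S X Z (?G \<odot> ?F \<odot> i X)) (?G \<odot> S X Y (?F \<odot> i X))"
      by (rule mu_iso) (simp_all add: hom_def)
    show "?G \<rhd> \<mu> X X Y f (i X) \<in> iso_cell D (?G \<odot> S X Y (?F \<odot> i X)) (?G \<odot> ?F \<odot> ?I)"
      by (rule D.iso_cell_HComp[OF mu_iso D.Id2_iso_cell]) (simp_all add: f i)
    show "?A \<in> iso_cell D (?G \<odot> ?F \<odot> ?I) (?G \<odot> ?F)"
      by (rule D.iso_cell_HComp[OF theta_right_iso D.Id2_iso_cell]) simp_all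
  qed
  then have "S2 X Z ?E = S2 X Z ?E'"
    by (rule D.iso_cell_cancel_left[OF _ eq]) simp_all
  then show ?thesis
    by (rule ext2_faithful[rotated 2]) simp_all
qed

text \<open>Followed by the invertible \<open>\<theta> X\<close>, each side becomes
  \<open>\<theta> X \<star> \<theta> X\<close> followed by a unit isomorphism at
  \<open>Id1 D (T X)\<close>; these agree by \<open>LUnit_Id1\<close>.\<close>

lemma theta_left_eq_right:
  assumes [simp]: "X \<in> Obj C"
  shows "theta_left X (S X X (i X)) = theta_right X (S X X (i X))"
proof (rule D.iso_cell_cancel_left[OF theta_iso])
  let ?I = "S X X (i X)"
  let ?U = "Id1 D (T X)"
  have "\<theta> X \<cdot> theta_left X ?I = theta_left X ?U \<cdot> (?I \<rhd> \<theta> X)"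
    by (rule theta_left_natural[symmetric]) simp_all
  also have "\<dots> = LUnit D ?U \<cdot> (\<theta> X \<star> \<theta> X)"
    by (simp add: theta_left_def D.interchange_cells)
  also have "\<dots> = RUnit D ?U \<cdot> (\<theta> X \<star> \<theta> X)"
    by (simp add: D.LUnit_Id1)
  also have "\<dots> = theta_right X ?U \<cdot> (\<theta> X \<lhd> ?I)"
    by (simp add: theta_right_def D.interchange_cells)
  also have "\<dots> = \<theta> X \<cdot> theta_right X ?I"
    by (rule theta_right_natural) simp_all
  finally show "\<theta> X \<cdot> theta_left X ?I = \<theta> X \<cdot> theta_right X ?I" .
qed simp_all

text \<open>Axiom 1. Applying the faithful \<open>S2 X X\<close> and axiom 3 at \<open>i X\<close>
  gives the unit axiom, up to exchanging \<open>theta_left\<close> for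
  \<open>theta_right\<close>.\<close>

lemma theta_eta:
  assumes [simp]: "X \<in> Obj C"
  shows "theta_left X (i X) \<cdot> \<eta> X X (i X) = Id2 D (i X)"
proof -
  have "S2 X X (theta_left X (i X) \<cdot> \<eta> X X (i X))
      = (theta_left X (S X X (i X)) \<cdot> \<mu> X X X (i X) (i X)) \<cdot> S2 X X (\<eta> X X (i X))"
    by (subst theta_left_mu) (simp_all add: ext2_VComp hom_def)
  also have "\<dots> = S2 X X (Id2 D (i X))"
    by (simp add: theta_left_eq_right unit_theta_right)
  finally show ?thesis
    by (rule ext2_faithful[rotated 2]) simp_all
qed

end

section \<open>Passing to inverse 2-cells\<close>

text \<open>The inverse of \<open>invert_structure\<close>. The restrictions keep all components
  extensional, so that the round trips are equalities of records.\<close>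

definition revert_structure ::
    "('o, 'm, 'c) bicat \<Rightarrow> ('o, 'm, 'c) no_iter_psmonad \<Rightarrow> ('o, 'o, 'm, 'c) rel_psmonad" where
  "revert_structure C N = \<lparr>
     ob = ob N, un = un N, ext1 = ext1 N, ext2 = ext2 N,
     mu = (\<lambda>X \<in> Obj C. \<lambda>Y \<in> Obj C. \<lambda>Z \<in> Obj C.
              \<lambda>g \<in> hom C Y (ob N Z). \<lambda>f \<in> hom C X (ob N Y). inv_cell C (mu' N X Y Z g f)),
     eta = (\<lambda>X \<in> Obj C. \<lambda>Y \<in> Obj C. \<lambda>f \<in> hom C X (ob N Y). inv_cell C (eta' N X Y f)),
     theta = (\<lambda>X \<in> Obj C. inv_cell C (theta' N X))\<rparr>"

section \<open>From relative pseudomonads over the identity to no-iteration pseudomonads\<close>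

lemma pobj_id_psfunctor [simp]: "pobj (id_psfunctor C) X = X"
  by (simp add: id_psfunctor_def)

lemma no_iteration_invert_structure:
  assumes "relative_pseudomonad C C (id_psfunctor C) R"
  shows "no_iteration_pseudomonad C (invert_structure C R)"
proof -
  interpret relative_pseudomonad C C "id_psfunctor C" R by (rule assms)
  let ?N = "invert_structure C R"
  have [simp]: "ob ?N = ob R" "un ?N = un R" "ext1 ?N = ext1 R" "ext2 ?N = ext2 R"
    by (simp_all add: invert_structure_def)
  note mu_iso' = mu_iso[simplified pobj_id_psfunctor]
    and eta_iso' = eta_iso[simplified pobj_id_psfunctor]
  \<comment> \<open>The no-iteration axioms speak of inverses of the primed 2-cells; double
    inversion returns the 2-cells of \<open>R\<close>.\<close>
  have mu': "inv_cell C (mu' ?N X Y Z g f) = mu R X Y Z g f"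
    if "X \<in> Obj C" "Y \<in> Obj C" "Z \<in> Obj C" "g \<in> hom C Y (ob R Z)" "f \<in> hom C X (ob R Y)" for X Y Z g f
    using C.inv_cell_inv_cell[OF mu_iso'[OF that]] that by (simp add: invert_structure_def)
  have eta': "inv_cell C (eta' ?N X Y f) = eta R X Y f"
    if "X \<in> Obj C" "Y \<in> Obj C" "f \<in> hom C X (ob R Y)" for X Y f
    using C.inv_cell_inv_cell[OF eta_iso'[OF that]] that by (simp add: invert_structure_def)
  have theta': "inv_cell C (theta' ?N X) = theta R X" if "X \<in> Obj C" for X
    using C.inv_cell_inv_cell[OF theta_iso[OF that]] that by (simp add: invert_structure_def)
  have comp: "Comp1 C (ext1 R Y Z g) f \<in> hom C X (ob R Z)"
    if "X \<in> Obj C" "Y \<in> Obj C" "Z \<in> Obj C" "g \<in> hom C Y (ob R Z)" "f \<in> hom C X (ob R Y)" for X Y Z g f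
    using that by (simp add: hom_def)
  have un: "un R X \<in> hom C X (ob R X)" if "X \<in> Obj C" for X
    using that by (simp add: hom_def)
  \<comment> \<open>Goals 1 to 8 are typing conditions, and goals 9 to 16 are axioms 1 to 8 in
    order. Goals 9, 11 and 13 use the derived laws.\<close>
  show ?thesis
  proof (intro no_iteration_pseudomonad.intro no_iteration_pseudomonad_data.intro
      no_iteration_pseudomonad_axioms.intro C.bicategory_axioms, goal_cases)
    case 1 show ?case using ob_typing by simp
  next
    case 2 show ?case using un_typing by simp
  next
    case 3 show ?case using ext_extensional by simp
  next
    case 4 show ?case using ext_extensional by simp
  next
    case (5 X Y) then show ?case using ext_functor by simp
  next
    case 6 show ?case
      using mu_iso' C.inv_cell_iso by (auto simp: invert_structure_def)
  next
    case 7 show ?case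
      using eta_iso' C.inv_cell_iso by (auto simp: invert_structure_def)
  next
    case 8 show ?case
      using theta_iso C.inv_cell_iso by (auto simp: invert_structure_def)
  next
    case (9 X)
    then show ?case
      using theta_eta[of X] un by (simp add: eta' theta' theta_left_def)
  next
    case (10 X Y f)
    then show ?case
      using unit[of X Y f] un by (simp add: mu' eta' theta')
  next
    \<comment> \<open>Axiom 3 applies \<open>S2\<close> separately to the two factors of
      \<open>theta_left\<close>; the typing of \<open>f\<close> allows \<open>ext2_VComp\<close> to
      split them.\<close>
    case (11 X Y f)
    then have "f \<in> Arr C" "Src C f = X" "Trg C f = ob R Y" by (auto simp: hom_def)
    with 11 show ?case
      using theta_left_mu[of X Y f] un by (simp add: mu' theta' theta_left_def ext2_VComp)
  next
    case (12 X Y f f' \<alpha>)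
    then show ?case using eta_natural[of X Y f f' \<alpha>] by (simp add: eta')
  next
    case (13 X Y Z f g)
    then show ?case using mu_eta[of X Y Z f g] comp by (simp add: mu' eta')
  next
    case (14 X Y Z g f f' \<alpha>)
    then show ?case using mu_natural_f[of X Y Z g f f' \<alpha>] by (simp add: mu')
  next
    case (15 X Y Z f g g' \<beta>)
    then show ?case using mu_natural_g[of X Y Z f g g' \<beta>] by (simp add: mu')
  next
    case (16 X Y Z V f g h)
    then show ?case using associativity[of X Y Z V f g h] comp by (simp add: mu')
  qed
qed

text \<open>On meaningful arguments this is double inversion; elsewhere both records are undefined
  by extensionality.\<close>

lemma revert_invert_structure:
  assumes "relative_pseudomonad C C (id_psfunctor C) R"
  shows "revert_structure C (invert_structure C R) = R"
proof -
  interpret relative_pseudomonad C C "id_psfunctor C" R by (rule assms)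
  note mu_iso' = mu_iso[simplified pobj_id_psfunctor]
    and eta_iso' = eta_iso[simplified pobj_id_psfunctor]
  let ?R = "revert_structure C (invert_structure C R)"
  have "mu ?R = mu R"
    using mu_typing C.inv_cell_inv_cell[OF mu_iso']
    by (auto simp: revert_structure_def invert_structure_def restrict_def PiE_iff extensional_def fun_eq_iff)
  moreover have "eta ?R = eta R"
    using eta_typing C.inv_cell_inv_cell[OF eta_iso']
    by (auto simp: revert_structure_def invert_structure_def restrict_def PiE_iff extensional_def fun_eq_iff)
  moreover have "theta ?R = theta R"
    using theta_typing C.inv_cell_inv_cell[OF theta_iso]
    by (auto simp: revert_structure_def invert_structure_def restrict_def PiE_iff extensional_def fun_eq_iff)
  ultimately show ?thesis
    by (simp add: revert_structure_def invert_structure_def)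
qed

section \<open>From no-iteration pseudomonads back to relative pseudomonads\<close>

context no_iteration_pseudomonad
begin

lemma mu'_iso:
  assumes "X \<in> Obj C" "Y \<in> Obj C" "Z \<in> Obj C" "g \<in> hom C Y (T Z)" "f \<in> hom C X (T Y)"
  shows "mu' N X Y Z g f \<in> iso_cell C (S Y Z g \<odot> S X Y f) (S X Z (S Y Z g \<odot> f))"
  using mu'_typing assms by (auto simp: PiE_iff)

lemma eta'_iso:
  assumes "X \<in> Obj C" "Y \<in> Obj C" "f \<in> hom C X (T Y)"
  shows "eta' N X Y f \<in> iso_cell C (S X Y f \<odot> i X) f"
  using eta'_typing assms by (auto simp: PiE_iff)

lemma theta'_iso: "X \<in> Obj C \<Longrightarrow> theta' N X \<in> iso_cell C (Id1 C (T X)) (S X X (i X))"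
  using theta'_typing by (auto simp: PiE_iff)

text \<open>Axioms 6, 7, 4, 8 and 2 become, in this order, the naturality laws, associativity and
  the unit law.\<close>

lemma relative_revert_structure: "relative_pseudomonad C C (id_psfunctor C) (revert_structure C N)"
proof -
  let ?R = "revert_structure C N"
  have [simp]: "ob ?R = T" "un ?R = i" "ext1 ?R = S" "ext2 ?R = S2"
    by (simp_all add: revert_structure_def)
  have mu: "mu ?R X Y Z g f = inv_cell C (mu' N X Y Z g f)"
    if "X \<in> Obj C" "Y \<in> Obj C" "Z \<in> Obj C" "g \<in> hom C Y (T Z)" "f \<in> hom C X (T Y)" for X Y Z g f
    using that by (simp add: revert_structure_def)
  have eta: "eta ?R X Y f = inv_cell C (eta' N X Y f)"
    if "X \<in> Obj C" "Y \<in> Obj C" "f \<in> hom C X (T Y)" for X Y f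
    using that by (simp add: revert_structure_def)
  have theta: "theta ?R X = inv_cell C (theta' N X)" if "X \<in> Obj C" for X
    using that by (simp add: revert_structure_def)
  have un: "i X \<in> hom C X (T X)" if "X \<in> Obj C" for X
    using un_typing that by auto
  have comp: "S Y Z g \<odot> f \<in> hom C X (T Z)"
    if "X \<in> Obj C" "Y \<in> Obj C" "Z \<in> Obj C" "g \<in> hom C Y (T Z)" "f \<in> hom C X (T Y)" for X Y Z g f
  proof (rule Comp1_hom)
    show "S Y Z g \<in> hom C (T Y) (T Z)"
      using ext_functor[of Y Z] that by (auto simp: hom_functor_def)
  qed (rule that)
  show ?thesis
  proof (intro relative_pseudomonad.intro relative_pseudomonad_data.intro
      relative_pseudomonad_axioms.intro pseudofunctor_id, unfold pobj_id_psfunctor, goal_cases)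
    case 1 show ?case using ob_typing by simp
  next
    case 2 show ?case using un_typing by simp
  next
    case 3 show ?case using ext_extensional by simp
  next
    case 4 show ?case using ext_extensional by simp
  next
    case (5 X Y) then show ?case using ext_functor by simp
  next
    case 6 show ?case
      using mu'_iso inv_cell_iso by (auto simp: revert_structure_def)
  next
    case 7 show ?case
      using eta'_iso inv_cell_iso by (auto simp: revert_structure_def)
  next
    case 8 show ?case
      using theta'_iso inv_cell_iso by (auto simp: revert_structure_def)
  next
    case (9 X Y Z g f f' \<alpha>)
    then show ?case using axiom6[of X Y Z g f f' \<alpha>] by (simp add: mu)
  next
    case (10 X Y Z f g g' \<beta>)
    then show ?case using axiom7[of X Y Z f g g' \<beta>] by (simp add: mu)
  next
    case (11 X Y f f' \<alpha>)
    then show ?case using axiom4[of X Y f f' \<alpha>] by (simp add: eta)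
  next
    case (12 X Y Z V f g h)
    then show ?case using axiom8[of X Y Z V f g h] comp by (simp add: mu)
  next
    case (13 X Y f)
    then show ?case using axiom2[of X Y f] un by (simp add: mu eta theta)
  qed
qed

lemma invert_revert_structure: "invert_structure C (revert_structure C N) = N"
proof -
  let ?N = "invert_structure C (revert_structure C N)"
  have "mu' ?N = mu' N"
    using mu'_typing inv_cell_inv_cell[OF mu'_iso]
    by (auto simp: revert_structure_def invert_structure_def restrict_def PiE_iff extensional_def fun_eq_iff)
  moreover have "eta' ?N = eta' N"
    using eta'_typing inv_cell_inv_cell[OF eta'_iso]
    by (auto simp: revert_structure_def invert_structure_def restrict_def PiE_iff extensional_def fun_eq_iff)
  moreover have "theta' ?N = theta' N"
    using theta'_typing inv_cell_inv_cell[OF theta'_iso]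
    by (auto simp: revert_structure_def invert_structure_def restrict_def PiE_iff extensional_def fun_eq_iff)
  ultimately show ?thesis
    by (simp add: revert_structure_def invert_structure_def)
qed

end

theorem proposition3p3:
  fixes C :: "('o, 'm, 'c) bicat"
  assumes "bicategory C"
  shows "bij_betw (invert_structure C)
           {R. relative_pseudomonad C C (id_psfunctor C) R}
           {N. no_iteration_pseudomonad C N}"
  by (rule bij_betwI[where g = "revert_structure C"])
    (auto simp: no_iteration_invert_structure revert_invert_structure
      no_iteration_pseudomonad.relative_revert_structure
      no_iteration_pseudomonad.invert_revert_structure)

end
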